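(* Let $G^\sigma$ be an oriented graph whose underlying graph $G$ is a simple connected graph on $n$ vertices. Then $$sr(G^\sigma)+2\alpha(G)\geqslant 2n-2d(G).$$ Equality holds if and only if all of the following hold: (i) the cycles (if any) of $G$ are pairwise vertex-disjoint; (ii) each cycle of $G^\sigma$ is either odd or evenly-oriented; (iii) $\alpha(T_G)=\alpha(\Gamma_G)+d(G)$.
   Context: An oriented graph $G^\sigma$ is obtained from a simple graph $G$ (its underlying graph) by assigning a direction to each edge. Its skew-adjacency matrix $S(G^\sigma)=[s_{x,y}]$ has $s_{x,y}=1$ if there is an arc from $x$ to $y$, $s_{x,y}=-1$ if there is an arc from $y$ to $x$, and $0$ otherwise; the skew-rank $sr(G^\sigma)$ is the rank of $S(G^\sigma)$. $\alpha(G)$ is the independence number of $G$. $d(G)=|E_G|-|V_G|+\omega(G)$, where $\omega(G)$ is the number of connected components. For an even cycle $C_k=v_1v_2\cdots v_kv_1$ in $G^\sigma$, its sign is the sign of $s_{v_1,v_2}s_{v_2,v_3}\cdots s_{v_{k-1},v_k}s_{v_k,v_1}$; the cycle is evenly-oriented if this sign is positive and oddly-oriented if negative. When the cycles of $G$ are pairwise vertex-disjoint, $T_G$ is the acyclic graph obtained from $G$ by contracting each cycle to a single vertex, and $\Gamma_G$ is the graph obtained from $G$ by deleting all vertices lying on cycles together with their incident edges (equivalently, $T_G$ minus the vertices corresponding to the contracted cycles). *)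

theory Defs
  imports "HOL-Analysis.Analysis"
begin

definition independent_set :: "'v set \<Rightarrow> ('v \<Rightarrow> 'v \<Rightarrow> bool) \<Rightarrow> 'v set \<Rightarrow> bool" where
  "independent_set V adj S \<longleftrightarrow> S \<subseteq> V \<and> (\<forall>x\<in>S. \<forall>y\<in>S. \<not> adj x y)"

text \<open>Independence number alpha (V is assumed finite).\<close>
definition indep_num :: "'v set \<Rightarrow> ('v \<Rightarrow> 'v \<Rightarrow> bool) \<Rightarrow> nat" where
  "indep_num V adj = Max {card S | S. independent_set V adj S}"

definition edge_set :: "'v set \<Rightarrow> ('v \<Rightarrow> 'v \<Rightarrow> bool) \<Rightarrow> 'v set set" where
  "edge_set V adj = {{x, y} | x y. x \<in> V \<and> y \<in> V \<and> adj x y}"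

definition reach :: "'v set \<Rightarrow> ('v \<Rightarrow> 'v \<Rightarrow> bool) \<Rightarrow> 'v \<Rightarrow> 'v \<Rightarrow> bool" where
  "reach V adj = (\<lambda>a b. a \<in> V \<and> b \<in> V \<and> adj a b)\<^sup>*\<^sup>*"

definition graph_connected :: "'v set \<Rightarrow> ('v \<Rightarrow> 'v \<Rightarrow> bool) \<Rightarrow> bool" where
  "graph_connected V adj \<longleftrightarrow> V \<noteq> {} \<and> (\<forall>x\<in>V. \<forall>y\<in>V. reach V adj x y)"

definition num_components :: "'v set \<Rightarrow> ('v \<Rightarrow> 'v \<Rightarrow> bool) \<Rightarrow> nat" where
  "num_components V adj = card (V // {(x, y). x \<in> V \<and> y \<in> V \<and> reach V adj x y})"

definition dim_cycle :: "'v set \<Rightarrow> ('v \<Rightarrow> 'v \<Rightarrow> bool) \<Rightarrow> int" where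
  "dim_cycle V adj = int (card (edge_set V adj)) - int (card V) + int (num_components V adj)"

definition is_cycle :: "'v set \<Rightarrow> ('v \<Rightarrow> 'v \<Rightarrow> bool) \<Rightarrow> 'v list \<Rightarrow> bool" where
  "is_cycle V adj c \<longleftrightarrow> length c \<ge> 3 \<and> distinct c \<and> set c \<subseteq> V \<and>
     (\<forall>i < length c. adj (c ! i) (c ! (Suc i mod length c)))"

text \<open>The cycle as a subgraph is determined by its edge set.\<close>
definition cycle_edges :: "'v list \<Rightarrow> 'v set set" where
  "cycle_edges c = {{c ! i, c ! (Suc i mod length c)} | i. i < length c}"

definition on_cycle :: "'v set \<Rightarrow> ('v \<Rightarrow> 'v \<Rightarrow> bool) \<Rightarrow> 'v set" where
  "on_cycle V adj = {v. \<exists>c. is_cycle V adj c \<and> v \<in> set c}"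

definition cycles_disjoint :: "'v set \<Rightarrow> ('v \<Rightarrow> 'v \<Rightarrow> bool) \<Rightarrow> bool" where
  "cycles_disjoint V adj \<longleftrightarrow> (\<forall>c1 c2. is_cycle V adj c1 \<and> is_cycle V adj c2 \<and>
      cycle_edges c1 \<noteq> cycle_edges c2 \<longrightarrow> set c1 \<inter> set c2 = {})"

text \<open>Gamma_G: delete all vertices on cycles (induced subgraph on the remaining ones).\<close>
definition Gamma_V :: "'v set \<Rightarrow> ('v \<Rightarrow> 'v \<Rightarrow> bool) \<Rightarrow> 'v set" where
  "Gamma_V V adj = V - on_cycle V adj"

text \<open>T_G: contract each cycle to a single vertex. Vertices: Inl v for v not on a cycle,
  Inr C for C the vertex set of a cycle.\<close>
definition T_V :: "'v set \<Rightarrow> ('v \<Rightarrow> 'v \<Rightarrow> bool) \<Rightarrow> ('v + 'v set) set" where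
  "T_V V adj = Inl ` (V - on_cycle V adj) \<union> Inr ` {set c | c. is_cycle V adj c}"

fun T_adj :: "('v \<Rightarrow> 'v \<Rightarrow> bool) \<Rightarrow> ('v + 'v set) \<Rightarrow> ('v + 'v set) \<Rightarrow> bool" where
  "T_adj adj (Inl u) (Inl v) = adj u v"
| "T_adj adj (Inl u) (Inr C) = (\<exists>w\<in>C. adj u w)"
| "T_adj adj (Inr C) (Inl u) = (\<exists>w\<in>C. adj w u)"
| "T_adj adj (Inr C) (Inr D) = (C \<noteq> D \<and> (\<exists>x\<in>C. \<exists>y\<in>D. adj x y))"

text \<open>ori x y: there is an arc from x to y.\<close>
definition oriented :: "('n \<Rightarrow> 'n \<Rightarrow> bool) \<Rightarrow> bool" where
  "oriented ori \<longleftrightarrow> (\<forall>x. \<not> ori x x) \<and> (\<forall>x y. ori x y \<longrightarrow> \<not> ori y x)"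

definition underlying :: "('n \<Rightarrow> 'n \<Rightarrow> bool) \<Rightarrow> 'n \<Rightarrow> 'n \<Rightarrow> bool" where
  "underlying ori x y \<longleftrightarrow> ori x y \<or> ori y x"

definition skew_adj :: "('n::finite \<Rightarrow> 'n \<Rightarrow> bool) \<Rightarrow> real^'n^'n" where
  "skew_adj ori = (\<chi> x y. if ori x y then 1 else if ori y x then -1 else 0)"

definition skew_rank :: "('n::finite \<Rightarrow> 'n \<Rightarrow> bool) \<Rightarrow> nat" where
  "skew_rank ori = rank (skew_adj ori)"

definition cycle_sign_prod :: "('n::finite \<Rightarrow> 'n \<Rightarrow> bool) \<Rightarrow> 'n list \<Rightarrow> real" where
  "cycle_sign_prod ori c = (\<Prod>i<length c. skew_adj ori $ (c ! i) $ (c ! (Suc i mod length c)))"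

definition cycles_odd_or_evenly :: "('n::finite \<Rightarrow> 'n \<Rightarrow> bool) \<Rightarrow> bool" where
  "cycles_odd_or_evenly ori \<longleftrightarrow> (\<forall>c. is_cycle UNIV (underlying ori) c \<longrightarrow>
      odd (length c) \<or> cycle_sign_prod ori c > 0)"

end

theory Submission
  imports Defs
begin

text \<open>
  For an induced subgraph on \<open>V\<close> let \<open>excess V = 2 \<alpha>(V) + 2 d(V) - |V| - nullity(V)\<close>; on the whole
  graph this is the difference of the two sides of the inequality. Deleting a vertex changes the
  nullity by exactly one, and deleting a vertex of a cycle lowers \<open>d\<close>, so such a deletion does not
  increase the excess. Deleting isolated vertices and pendant edges shows that the excess of a
  forest vanishes, whence the inequality.

  If the excess vanishes, then deleting any vertex of a cycle lowers \<open>d\<close> by exactly one, so the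
  cycles are disjoint. For disjoint cycles the remaining conditions are compared with the vanishing
  of the excess by induction: there is a vertex of degree at most one, or a cycle \<open>C\<close> joined to
  the rest \<open>R\<close> by at most one edge \<open>xy\<close>. In the latter case a null vector of \<open>C\<close> exists iff
  \<open>C\<close> is odd or evenly-oriented, and then some null vector on \<open>V\<close> is nonzero at \<open>x\<close> iff all null
  vectors on \<open>R\<close> vanish at \<open>y\<close>.
\<close>

section \<open>Independent sets\<close>

text \<open>Nullity replaces rank because the principal submatrix on V can then be studied through
  vectors supported on V, all inside one matrix. Deletions may disconnect the graph, so everything
  is stated for arbitrary vertex sets, with d counting components. Condition (iii) lives on another
  vertex type and is awkward under deletion; it is replaced by \<open>separated\<close>: no two
  cycles are adjacent, and some maximum independent set of Gamma has no neighbour on a cycle. The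
  obstacle is an end cycle joined to the rest R by an edge xy with y in Gamma. Such an independent
  set must avoid y, and vanishing excess of R alone does not give one. The null vector nonzero at x
  makes all null vectors of R vanish at y, so R without y also has excess 0 and the same
  independence number; comparing the two yields a maximum set that avoids y.\<close>

lemma indep_num_ge:
  assumes "finite V" "independent_set V adj S"
  shows "card S \<le> indep_num V adj"
proof -
  have "{card S | S. independent_set V adj S} \<subseteq> card ` Pow V"
    by (auto simp: independent_set_def)
  then have "finite {card S | S. independent_set V adj S}"
    using assms(1) by (meson finite_Pow_iff finite_imageI finite_subset)
  then show ?thesis
    unfolding indep_num_def using assms(2) by (intro Max_ge) auto
qed

lemma indep_num_attained:
  assumes "finite V"
  obtains S where "independent_set V adj S" "card S = indep_num V adj"
proof -
  have "{card S | S. independent_set V adj S} \<subseteq> card ` Pow V"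
    by (auto simp: independent_set_def)
  then have "finite {card S | S. independent_set V adj S}"
    using assms(1) by (meson finite_Pow_iff finite_imageI finite_subset)
  moreover have "independent_set V adj {}" by (simp add: independent_set_def)
  ultimately have "indep_num V adj \<in> {card S | S. independent_set V adj S}"
    unfolding indep_num_def by (intro Max_in) auto
  then show ?thesis using that by auto
qed

lemma indep_num_leI:
  assumes "finite V" "\<And>S. independent_set V adj S \<Longrightarrow> card S \<le> n"
  shows "indep_num V adj \<le> n"
  using assms by (metis indep_num_attained)

lemma indep_num_mono:
  assumes "finite W" "V \<subseteq> W"
  shows "indep_num V adj \<le> indep_num W adj"
proof (rule indep_num_leI)
  show "finite V" using assms finite_subset by blast
  fix S assume "independent_set V adj S"
  then have "independent_set W adj S" using assms by (auto simp: independent_set_def)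
  then show "card S \<le> indep_num W adj" using assms indep_num_ge by blast
qed

lemma indep_num_Un_le:
  assumes "finite V" "finite W"
  shows "indep_num (V \<union> W) adj \<le> indep_num V adj + indep_num W adj"
proof (rule indep_num_leI)
  show "finite (V \<union> W)" using assms by simp
  fix S assume S: "independent_set (V \<union> W) adj S"
  then have "independent_set V adj (S \<inter> V)" "independent_set W adj (S \<inter> W)"
    by (auto simp: independent_set_def)
  moreover have "card S \<le> card (S \<inter> V) + card (S \<inter> W)"
    using S by (metis Int_Un_distrib card_Un_le independent_set_def inf.absorb1)
  ultimately show "card S \<le> indep_num V adj + indep_num W adj"
    using indep_num_ge assms by (meson add_mono le_trans)
qed

lemma indep_num_Un_nonadj:
  assumes "finite V" "finite W" "V \<inter> W = {}"
    and "\<And>a b. a \<in> V \<Longrightarrow> b \<in> W \<Longrightarrow> \<not> adj a b \<and> \<not> adj b a"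
  shows "indep_num (V \<union> W) adj = indep_num V adj + indep_num W adj"
proof (rule antisym)
  obtain S where S: "independent_set V adj S" "card S = indep_num V adj"
    using indep_num_attained assms(1) by blast
  obtain T where T: "independent_set W adj T" "card T = indep_num W adj"
    using indep_num_attained assms(2) by blast
  have "independent_set (V \<union> W) adj (S \<union> T)"
    using S T assms(4) unfolding independent_set_def by blast
  moreover have "card (S \<union> T) = card S + card T"
    using S(1) T(1) assms(1-3) unfolding independent_set_def
    by (intro card_Un_disjoint) (auto intro: finite_subset)
  ultimately show "indep_num V adj + indep_num W adj \<le> indep_num (V \<union> W) adj"
    using S T assms by (metis finite_UnI indep_num_ge)
qed (use assms indep_num_Un_le in blast)

lemma indep_num_empty [simp]: "indep_num {} adj = 0"
  by (metis card.empty finite.emptyI indep_num_attained independent_set_def subset_empty)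

lemma indep_num_le_card: "finite V \<Longrightarrow> indep_num V adj \<le> card V"
  by (rule indep_num_leI) (auto simp: independent_set_def intro: card_mono)

section \<open>Paths and cycles\<close>

lemma distinct_path_of_reach:
  assumes "reach V adj a b" "b \<in> V"
  obtains p where "p \<noteq> []" "hd p = a" "last p = b" "distinct p" "set p \<subseteq> V"
    "successively adj p"
proof -
  from assms(1) have "(\<lambda>a b. a \<in> V \<and> b \<in> V \<and> adj a b)\<^sup>*\<^sup>* a b"
    by (simp add: reach_def)
  then have "\<exists>p. p \<noteq> [] \<and> hd p = a \<and> last p = b \<and> distinct p \<and> set p \<subseteq> V \<and> successively adj p"
  proof (induction rule: converse_rtranclp_induct)
    case base
    show ?case using assms(2) by (intro exI[of _ "[b]"]) auto
  next
    case (step a z)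
    then obtain p where p: "p \<noteq> []" "hd p = z" "last p = b" "distinct p" "set p \<subseteq> V"
      "successively adj p" by blast
    show ?case
    proof (cases "a \<in> set p")
      case True
      then obtain us ws where "p = us @ a # ws" by (meson split_list)
      then show ?thesis using p
        by (intro exI[of _ "a # ws"]) (auto simp: successively_append_iff)
    next
      case False
      then show ?thesis using p step(1)
        by (intro exI[of _ "a # p"]) (auto simp: successively_Cons)
    qed
  qed
  then show ?thesis using that by blast
qed

lemma reach_of_path:
  assumes "successively adj p" "set p \<subseteq> V" "p \<noteq> []"
  shows "reach V adj (hd p) (last p)"
  using assms
proof (induction p rule: induct_list012)
  case (3 x y zs)
  then have "reach V adj y (last (y # zs))" by simp
  then show ?case using 3 unfolding reach_def
    by (auto intro: converse_rtranclp_into_rtranclp)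
qed (auto simp: reach_def)

lemma is_cycleI_path:
  assumes "distinct p" "set p \<subseteq> V" "successively adj p" "length p \<ge> 3" "adj (last p) (hd p)"
  shows "is_cycle V adj p"
  unfolding is_cycle_def
proof (intro conjI allI impI)
  fix i assume i: "i < length p"
  show "adj (p ! i) (p ! (Suc i mod length p))"
  proof (cases "Suc i < length p")
    case True
    then show ?thesis using assms(3) by (simp add: successively_conv_nth)
  next
    case False
    then have "Suc i = length p" using i by simp
    moreover have "p \<noteq> []" using i by auto
    ultimately show ?thesis using assms(5)
      by (metis diff_Suc_1 hd_conv_nth last_conv_nth mod_self)
  qed
qed (use assms in auto)

lemma is_cycle_successively:
  assumes "is_cycle V adj c" shows "successively adj c"
  using assms unfolding is_cycle_def successively_conv_nth
  by (metis Suc_lessD mod_less)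

lemma is_cycle_mono: "is_cycle V adj c \<Longrightarrow> V \<subseteq> W \<Longrightarrow> is_cycle W adj c"
  unfolding is_cycle_def by blast

lemma is_cycle_restrict: "is_cycle V adj c \<Longrightarrow> set c \<subseteq> W \<Longrightarrow> is_cycle W adj c"
  unfolding is_cycle_def by blast

lemma is_cycle_nonempty: "is_cycle V adj c \<Longrightarrow> c \<noteq> []"
  unfolding is_cycle_def by auto

text \<open>Cycles are distinguished by edges in \<open>cycles_disjoint\<close> but named by
  vertices in \<open>T_V\<close>; this passes from one to the other.\<close>

lemma set_eq_Union_cycle_edges: "set c = \<Union> (cycle_edges c)"
proof (intro equalityI subsetI)
  fix x assume "x \<in> set c"
  then obtain i where "i < length c" "x = c ! i" by (metis in_set_conv_nth)
  then show "x \<in> \<Union> (cycle_edges c)"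
    unfolding cycle_edges_def by (intro UnionI[of "{c ! i, c ! (Suc i mod length c)}"]) auto
next
  fix x assume "x \<in> \<Union> (cycle_edges c)"
  then obtain i where "i < length c" "x = c ! i \<or> x = c ! (Suc i mod length c)"
    unfolding cycle_edges_def by auto
  moreover from this have "Suc i mod length c < length c"
    by (intro mod_less_divisor) auto
  ultimately show "x \<in> set c" by auto
qed

section \<open>Rotating a cycle to another starting vertex\<close>

lemma bij_betw_shift_mod:
  assumes "0 < (k::nat)"
  shows "bij_betw (\<lambda>i. (m + i) mod k) {..<k} {..<k}"
proof -
  have "inj_on (\<lambda>i. (m + i) mod k) {..<k}"
  proof (rule inj_onI)
    fix i j assume *: "i \<in> {..<k}" "j \<in> {..<k}" "(m + i) mod k = (m + j) mod k"
    then have "i mod k = j mod k"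
      unfolding nat_mod_eq_iff by (simp add: add.assoc)
    then show "i = j" using * by simp
  qed
  moreover have "(\<lambda>i. (m + i) mod k) ` {..<k} = {..<k}"
    using calculation assms by (intro endo_inj_surj) auto
  ultimately show ?thesis by (simp add: bij_betw_def)
qed

lemma nth_rotate_Suc:
  assumes "i < length c"
  shows "rotate m c ! (Suc i mod length c) = c ! (Suc ((m + i) mod length c) mod length c)"
proof -
  have "Suc i mod length c < length c" using assms by (metis gr_zeroI less_zeroE mod_less_divisor)
  then have "rotate m c ! (Suc i mod length c) = c ! ((m + Suc i mod length c) mod length c)"
    by (simp add: nth_rotate)
  then show ?thesis by (simp add: mod_simps)
qed

lemma is_cycle_rotate:
  assumes "is_cycle V adj c" shows "is_cycle V adj (rotate m c)"
  unfolding is_cycle_def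
proof (intro conjI allI impI)
  fix i assume "i < length (rotate m c)"
  then have i: "i < length c" by simp
  have "(m + i) mod length c < length c" using i by (metis gr_zeroI less_zeroE mod_less_divisor)
  then show "adj (rotate m c ! i) (rotate m c ! (Suc i mod length (rotate m c)))"
    using assms i unfolding is_cycle_def by (simp add: nth_rotate nth_rotate_Suc)
qed (use assms in \<open>auto simp: is_cycle_def\<close>)

lemma cycle_edges_rotate: "cycle_edges (rotate m c) = cycle_edges c"
proof (cases "c = []")
  case False
  let ?k = "length c"
  have "cycle_edges (rotate m c) = (\<lambda>i. {rotate m c ! i, rotate m c ! (Suc i mod ?k)}) ` {..<?k}"
    unfolding cycle_edges_def by auto
  also have "\<dots> = (\<lambda>i. {c ! i, c ! (Suc i mod ?k)}) ` (\<lambda>i. (m + i) mod ?k) ` {..<?k}"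
    unfolding image_image by (intro image_cong) (auto simp: nth_rotate nth_rotate_Suc)
  also have "(\<lambda>i. (m + i) mod ?k) ` {..<?k} = {..<?k}"
    using bij_betw_shift_mod[of ?k m] False by (simp add: bij_betw_def)
  also have "(\<lambda>i. {c ! i, c ! (Suc i mod ?k)}) ` {..<?k} = cycle_edges c"
    unfolding cycle_edges_def by auto
  finally show ?thesis .
qed simp

text \<open>Reduces claims about any vertex of a cycle to position 0: being a cycle, its edges and
  its sign product all survive rotation.\<close>

lemma obtain_rotation:
  assumes "x \<in> set c"
  obtains m where "rotate m c ! 0 = x"
proof -
  obtain i where "i < length c" "c ! i = x" using assms by (metis in_set_conv_nth)
  then have "rotate i c ! 0 = x"
    by (metis add.right_neutral length_pos_if_in_set assms mod_less nth_rotate)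
  then show ?thesis using that by blast
qed

text \<open>Only index 0 and the wrap-around index \<open>length c - 1\<close> give edges at the
  first vertex. Two cycles through a vertex can thus be compared by their edges there.\<close>

lemma cycle_edges_at_hd:
  assumes "is_cycle V adj c"
  shows "{e \<in> cycle_edges c. c ! 0 \<in> e} = {{c ! 0, c ! 1}, {c ! 0, last c}}"
proof -
  let ?k = "length c"
  have c: "?k \<ge> 3" "distinct c" "c \<noteq> []" using assms by (auto simp: is_cycle_def)
  have 1: "i = 0 \<or> i = ?k - 1" if "i < ?k" "c ! 0 \<in> {c ! i, c ! (Suc i mod ?k)}" for i
  proof (cases "Suc i < ?k")
    case True
    then show ?thesis using that c by (auto simp: nth_eq_iff_index_eq)
  qed (use that in auto)
  have 2: "{c ! 0, c ! 1} \<in> cycle_edges c"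
    unfolding cycle_edges_def using c by (auto intro!: exI[of _ 0])
  have "{c ! (?k - 1), c ! (Suc (?k - 1) mod ?k)} = {c ! 0, last c}"
    using c by (auto simp: last_conv_nth)
  then have 3: "{c ! 0, last c} \<in> cycle_edges c"
    unfolding cycle_edges_def using c
    by (metis (mono_tags, lifting) diff_less length_greater_0_conv less_numeral_extra(1) mem_Collect_eq)
  have "e \<in> {{c ! 0, c ! 1}, {c ! 0, last c}}" if e: "e \<in> cycle_edges c" "c ! 0 \<in> e" for e
  proof -
    obtain i where i: "i < ?k" "e = {c ! i, c ! (Suc i mod ?k)}"
      using e(1) unfolding cycle_edges_def by auto
    with 1[of i] e(2) consider "i = 0" | "i = ?k - 1" by auto
    then show ?thesis
    proof cases
      case 1
      then show ?thesis using i c by auto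
    next
      case 2
      then show ?thesis using i c by (auto simp: last_conv_nth)
    qed
  qed
  then show ?thesis using 2 3 by auto
qed

section \<open>Neighbours, reachability and cycles through a vertex\<close>

locale finite_graph =
  fixes adj :: "'a::finite \<Rightarrow> 'a \<Rightarrow> bool"
  assumes sym: "adj a b \<Longrightarrow> adj b a" and irrefl: "\<not> adj a a"
begin

lemma adj_commute: "adj a b \<longleftrightarrow> adj b a"
  using sym by blast

definition nbrs :: "'a set \<Rightarrow> 'a \<Rightarrow> 'a set" where
  "nbrs V x = {w \<in> V. adj x w}"

lemma reach_sym: "reach V adj a b \<Longrightarrow> reach V adj b a"
  unfolding reach_def
  by (induction rule: rtranclp_induct) (auto intro: converse_rtranclp_into_rtranclp sym)

lemma reach_trans: "reach V adj a b \<Longrightarrow> reach V adj b c \<Longrightarrow> reach V adj a c"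
  unfolding reach_def by auto

lemma reach_step: "a \<in> V \<Longrightarrow> b \<in> V \<Longrightarrow> adj a b \<Longrightarrow> reach V adj a b"
  unfolding reach_def by auto

lemma reach_mono: "reach V adj a b \<Longrightarrow> V \<subseteq> W \<Longrightarrow> reach W adj a b"
  unfolding reach_def by (erule rtranclp_mono[THEN predicate2D, rotated]) auto

text \<open>A simple path from \<open>a\<close> to \<open>b\<close> avoiding \<open>x\<close> closes
  up through \<open>x\<close>. With the converse \<open>cycle_hd_nbrs\<close>, cycles through
  \<open>x\<close> are detected by distinct neighbours lying in one component of the rest.\<close>

lemma cycle_of_reach_nbrs:
  assumes "a \<in> nbrs V x" "b \<in> nbrs V x" "a \<noteq> b" "reach (V - {x}) adj a b" "x \<in> V"
  obtains c where "is_cycle V adj c" "c ! 0 = x" "c ! 1 = a" "last c = b"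
proof -
  have "b \<in> V - {x}" using assms irrefl unfolding nbrs_def by auto
  then obtain p where p: "p \<noteq> []" "hd p = a" "last p = b" "distinct p" "set p \<subseteq> V - {x}"
    "successively adj p" using distinct_path_of_reach assms(4) by metis
  have "length p \<ge> 2" using p assms(3)
    by (metis One_nat_def Suc_1 hd_conv_nth last_conv_nth le_less_Suc_eq length_0_conv less_one
        not_less_eq_eq diff_Suc_1 linorder_not_less)
  have "is_cycle V adj (x # p)"
    using p assms \<open>length p \<ge> 2\<close> unfolding nbrs_def
    by (intro is_cycleI_path) (auto simp: successively_Cons adj_commute)
  then show ?thesis using that p by (metis One_nat_def hd_conv_nth last.simps nth_Cons_0 nth_Cons_Suc)
qed

lemma cycle_hd_nbrs:
  assumes "is_cycle V adj c"
  shows "c ! 1 \<in> nbrs V (c ! 0)" "last c \<in> nbrs V (c ! 0)" "c ! 1 \<noteq> last c"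
    "reach (V - {c ! 0}) adj (c ! 1) (last c)"
proof -
  let ?k = "length c"
  have c: "?k \<ge> 3" "distinct c" "set c \<subseteq> V" "c \<noteq> []" using assms by (auto simp: is_cycle_def)
  have a: "\<And>i. i < ?k \<Longrightarrow> adj (c ! i) (c ! (Suc i mod ?k))" using assms by (auto simp: is_cycle_def)
  show "c ! 1 \<in> nbrs V (c ! 0)"
    using a[of 0] c unfolding nbrs_def by (auto simp: subset_iff)
  have "last c = c ! (?k - 1)" using c by (simp add: last_conv_nth)
  moreover have "adj (c ! (?k - 1)) (c ! 0)" using a[of "?k - 1"] c by simp
  ultimately show "last c \<in> nbrs V (c ! 0)"
    using c unfolding nbrs_def by (auto simp: adj_commute)
  show "c ! 1 \<noteq> last c"
    using c \<open>last c = c ! (?k - 1)\<close> by (simp add: nth_eq_iff_index_eq)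
  obtain y q where yq: "c = y # q" using c by (cases c) auto
  then have "q \<noteq> []" using c by auto
  have "reach (V - {y}) adj (hd q) (last q)"
    using is_cycle_successively[OF assms] c yq \<open>q \<noteq> []\<close>
    by (intro reach_of_path) (auto simp: successively_Cons)
  then show "reach (V - {c ! 0}) adj (c ! 1) (last c)"
    using yq \<open>q \<noteq> []\<close> by (simp add: hd_conv_nth)
qed

lemma on_cycleE:
  assumes "x \<in> on_cycle V adj"
  obtains c where "is_cycle V adj c" "c ! 0 = x"
proof -
  obtain c where c: "is_cycle V adj c" "x \<in> set c" using assms unfolding on_cycle_def by auto
  obtain m where "rotate m c ! 0 = x" using obtain_rotation c(2) by metis
  then show ?thesis using that is_cycle_rotate[OF c(1)] by metis
qed

lemma on_cycle_subset: "on_cycle V adj \<subseteq> V"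
  unfolding on_cycle_def is_cycle_def by auto

lemma on_cycle_mono: "V \<subseteq> W \<Longrightarrow> on_cycle V adj \<subseteq> on_cycle W adj"
  unfolding on_cycle_def using is_cycle_mono by blast

lemma low_degree_not_on_cycle:
  assumes "card (nbrs V x) \<le> 1"
  shows "x \<notin> on_cycle V adj"
proof
  assume "x \<in> on_cycle V adj"
  then obtain c where c: "is_cycle V adj c" "c ! 0 = x" using on_cycleE by blast
  from cycle_hd_nbrs(1,2,3)[OF c(1)] have "{c ! 1, last c} \<subseteq> nbrs V x" "card {c ! 1, last c} = 2"
    using c(2) by auto
  then have "2 \<le> card (nbrs V x)" by (metis card_mono finite)
  then show False using assms by simp
qed

section \<open>Cycle rank and deletion of a vertex\<close>

definition comp_rel :: "'a set \<Rightarrow> ('a \<times> 'a) set" where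
  "comp_rel V = {(a, b). a \<in> V \<and> b \<in> V \<and> reach V adj a b}"

lemma equiv_comp_rel: "equiv V (comp_rel V)"
proof (rule equivI)
  show "comp_rel V \<subseteq> V \<times> V" unfolding comp_rel_def by auto
  show "refl_on V (comp_rel V)" unfolding refl_on_def comp_rel_def by (auto simp: reach_def)
  show "sym (comp_rel V)" unfolding comp_rel_def by (auto intro!: symI reach_sym)
  show "trans (comp_rel V)" unfolding comp_rel_def by (auto intro!: transI intro: reach_trans)
qed

text \<open>The deleted vertex \<open>x\<close> merges the components of the rest that contain a neighbour of \<open>x\<close>.\<close>
lemma num_components_delete:
  assumes "x \<in> V"
  shows "num_components V adj + card ((\<lambda>w. comp_rel (V - {x}) `` {w}) ` nbrs V x)
    = Suc (num_components (V - {x}) adj)"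
proof -
  let ?W = "V - {x}"
  let ?r = "comp_rel ?W" and ?s = "comp_rel V"
  define T where "T = (\<lambda>w. ?r `` {w}) ` nbrs V x"
  have nW: "nbrs V x \<subseteq> ?W" using irrefl unfolding nbrs_def by auto
  have T: "T \<subseteq> ?W // ?r" using nW unfolding T_def quotient_def by auto
  \<comment> \<open>An old component is absorbed exactly if it contains a neighbour of
    \<open>x\<close>: the vertex before \<open>x\<close> on a simple path is one.\<close>
  have reachx: "reach V adj a x \<longleftrightarrow> ?r `` {a} \<in> T" if a: "a \<in> ?W" for a
  proof
    assume "?r `` {a} \<in> T"
    then obtain w where w: "w \<in> nbrs V x" "?r `` {a} = ?r `` {w}" unfolding T_def by auto
    then have "(a, w) \<in> ?r" using equiv_comp_rel a nW
      by (metis eq_equiv_class_iff subsetD)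
    then have "reach V adj a w" unfolding comp_rel_def using reach_mono[of ?W a w V] by auto
    moreover have "reach V adj w x" using w assms unfolding nbrs_def
      by (auto intro: reach_step sym)
    ultimately show "reach V adj a x" using reach_trans by blast
  next
    assume "reach V adj a x"
    then obtain p where p: "p \<noteq> []" "hd p = a" "last p = x" "distinct p" "set p \<subseteq> V"
      "successively adj p" using distinct_path_of_reach assms by metis
    obtain q where q: "p = q @ [x]" using p by (metis append_butlast_last_id)
    then have "q \<noteq> []" using p a by auto
    have "reach ?W adj (hd q) (last q)"
      using p q \<open>q \<noteq> []\<close> by (intro reach_of_path) (auto simp: successively_append_iff)
    moreover have "hd q = a" using p q \<open>q \<noteq> []\<close> by auto
    moreover have "last q \<in> nbrs V x"
      using p q \<open>q \<noteq> []\<close> unfolding nbrs_def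
      by (auto simp: successively_append_iff adj_commute subset_iff)
    ultimately have "(a, last q) \<in> ?r" using a nW unfolding comp_rel_def by auto
    then have "?r `` {a} = ?r `` {last q}" using equiv_comp_rel by (metis equiv_class_eq)
    then show "?r `` {a} \<in> T" using \<open>last q \<in> nbrs V x\<close> unfolding T_def by auto
  qed
  have avoid: "?s `` {a} = ?r `` {a}" if a: "a \<in> ?W" "\<not> reach V adj a x" for a
  proof -
    have "reach ?W adj a b" if b: "reach V adj a b" for b
      using b[unfolded reach_def] unfolding reach_def
    proof (induction rule: rtranclp_induct)
      case (step y z)
      then have "reach V adj a y" "reach V adj a z"
        using reach_mono[of ?W a y V] reach_trans[OF _ reach_step, of V a y z]
        by (auto simp: reach_def[of ?W])
      then have "y \<noteq> x" "z \<noteq> x" using a by auto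
      then show ?case using step by (auto intro: rtranclp.rtrancl_into_rtrancl)
    qed simp
    moreover have "b \<noteq> x" if "reach V adj a b" for b using that a by auto
    ultimately show ?thesis using a reach_mono[of ?W a _ V] unfolding comp_rel_def by auto
  qed
  have "V // ?s = insert (?s `` {x}) (?W // ?r - T)"
  proof (intro equalityI subsetI)
    fix K assume "K \<in> V // ?s"
    then obtain a where a: "a \<in> V" "K = ?s `` {a}" by (auto elim: quotientE)
    show "K \<in> insert (?s `` {x}) (?W // ?r - T)"
    proof (cases "reach V adj a x")
      case True
      then have "(a, x) \<in> ?s" using a assms unfolding comp_rel_def by auto
      then show ?thesis using a equiv_comp_rel by (metis equiv_class_eq insertI1)
    next
      case False
      then have "a \<in> ?W" using a by (auto simp: reach_def)
      then show ?thesis using avoid[OF _ False] reachx False a(2)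
        by (auto simp: quotientI)
    qed
  next
    fix K assume "K \<in> insert (?s `` {x}) (?W // ?r - T)"
    then consider "K = ?s `` {x}" | "K \<in> ?W // ?r" "K \<notin> T" by blast
    then show "K \<in> V // ?s"
    proof cases
      case 1
      then show ?thesis using assms by (auto intro: quotientI)
    next
      case 2
      then obtain a where a: "a \<in> ?W" "K = ?r `` {a}" by (auto elim: quotientE)
      then have "K = ?s `` {a}" using avoid reachx 2 by metis
      then show ?thesis using a by (auto intro: quotientI)
    qed
  qed
  moreover have "?s `` {x} \<notin> ?W // ?r"
  proof
    assume "?s `` {x} \<in> ?W // ?r"
    then have "?s `` {x} \<subseteq> ?W" using equiv_comp_rel by (metis in_quotient_imp_subset)
    moreover have "x \<in> ?s `` {x}" using assms unfolding comp_rel_def reach_def by auto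
    ultimately show False by auto
  qed
  ultimately have "card (V // ?s) = Suc (card (?W // ?r - T))" by simp
  also have "card (?W // ?r - T) = card (?W // ?r) - card T"
    using T by (intro card_Diff_subset) (auto intro: finite)
  finally have "card (V // ?s) + card T = Suc (card (?W // ?r))"
    using card_mono[OF _ T] by (simp add: finite)
  then show ?thesis unfolding num_components_def T_def comp_rel_def by simp
qed

lemma card_edge_set_delete:
  assumes "x \<in> V"
  shows "card (edge_set V adj) = card (edge_set (V - {x}) adj) + card (nbrs V x)"
proof -
  have "edge_set V adj = edge_set (V - {x}) adj \<union> (\<lambda>w. {x, w}) ` nbrs V x"
  proof (intro equalityI subsetI)
    fix e assume "e \<in> edge_set V adj"
    then obtain a b where ab: "e = {a, b}" "a \<in> V" "b \<in> V" "adj a b"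
      unfolding edge_set_def by blast
    consider "a = x" | "b = x" | "a \<noteq> x" "b \<noteq> x" by blast
    then show "e \<in> edge_set (V - {x}) adj \<union> (\<lambda>w. {x, w}) ` nbrs V x"
    proof cases
      case 1
      then show ?thesis using ab unfolding nbrs_def by blast
    next
      case 2
      then have "e = {x, a}" "a \<in> nbrs V x" using ab sym unfolding nbrs_def by auto
      then show ?thesis by blast
    next
      case 3
      then show ?thesis using ab unfolding edge_set_def by blast
    qed
  next
    fix e assume "e \<in> edge_set (V - {x}) adj \<union> (\<lambda>w. {x, w}) ` nbrs V x"
    then show "e \<in> edge_set V adj" using assms unfolding edge_set_def nbrs_def by blast
  qed
  moreover have "edge_set (V - {x}) adj \<inter> (\<lambda>w. {x, w}) ` nbrs V x = {}"
  proof -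
    have "x \<notin> e" if "e \<in> edge_set (V - {x}) adj" for e
      using that unfolding edge_set_def by blast
    then show ?thesis by blast
  qed
  moreover have "card ((\<lambda>w. {x, w}) ` nbrs V x) = card (nbrs V x)"
    by (intro card_image inj_onI) (auto simp: doubleton_eq_iff)
  ultimately show ?thesis by (simp add: card_Un_disjoint finite)
qed

text \<open>Edges drop by the degree of \<open>x\<close>, vertices by one, and the component of
  \<open>x\<close> is replaced by those containing its neighbours. So d drops by the amount by which
  the map from neighbours to components fails to be injective.\<close>

lemma dim_cycle_delete:
  assumes "x \<in> V"
  shows "dim_cycle V adj = dim_cycle (V - {x}) adj + int (card (nbrs V x))
    - int (card ((\<lambda>w. comp_rel (V - {x}) `` {w}) ` nbrs V x))"
  using num_components_delete[OF assms] card_edge_set_delete[OF assms]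
    card_Suc_Diff1[of V x] assms unfolding dim_cycle_def by simp

lemma same_class_iff:
  assumes "a \<in> nbrs V x" "b \<in> nbrs V x"
  shows "comp_rel (V - {x}) `` {a} = comp_rel (V - {x}) `` {b} \<longleftrightarrow> reach (V - {x}) adj a b"
proof -
  have "a \<in> V - {x}" "b \<in> V - {x}" using assms irrefl unfolding nbrs_def by auto
  then show ?thesis using eq_equiv_class_iff[OF equiv_comp_rel, of a "V - {x}" b]
    unfolding comp_rel_def by simp
qed

lemma dim_cycle_delete_not_on_cycle:
  assumes "x \<in> V" "x \<notin> on_cycle V adj"
  shows "dim_cycle (V - {x}) adj = dim_cycle V adj"
proof -
  have "inj_on (\<lambda>w. comp_rel (V - {x}) `` {w}) (nbrs V x)"
  proof (rule inj_onI, rule ccontr)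
    fix a b assume ab: "a \<in> nbrs V x" "b \<in> nbrs V x"
      "comp_rel (V - {x}) `` {a} = comp_rel (V - {x}) `` {b}" "a \<noteq> b"
    then obtain c where "is_cycle V adj c" "c ! 0 = x"
      using cycle_of_reach_nbrs same_class_iff assms(1) by metis
    then show False using assms(2) is_cycle_nonempty unfolding on_cycle_def
      by (metis (mono_tags, lifting) length_greater_0_conv mem_Collect_eq nth_mem)
  qed
  then show ?thesis using dim_cycle_delete[OF assms(1)] by (simp add: card_image)
qed

lemma dim_cycle_delete_on_cycle:
  assumes "x \<in> on_cycle V adj"
  shows "dim_cycle (V - {x}) adj < dim_cycle V adj"
proof -
  have x: "x \<in> V" using assms on_cycle_subset by auto
  obtain c where c: "is_cycle V adj c" "c ! 0 = x" using assms on_cycleE by blast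
  have "\<not> inj_on (\<lambda>w. comp_rel (V - {x}) `` {w}) (nbrs V x)"
    using cycle_hd_nbrs[OF c(1)] c(2) same_class_iff unfolding inj_on_def by metis
  then have "card ((\<lambda>w. comp_rel (V - {x}) `` {w}) ` nbrs V x) < card (nbrs V x)"
    by (metis card_image_le eq_card_imp_inj_on finite le_neq_implies_less)
  then show ?thesis using dim_cycle_delete[OF x] by simp
qed

text \<open>A drop of at most one means that the image of the neighbours has at most one element
  fewer than they have, which leaves room for only one pair in a common component.\<close>

lemma cycle_nbrs_unique:
  assumes "x \<in> V" "dim_cycle V adj \<le> dim_cycle (V - {x}) adj + 1"
    and "a \<in> nbrs V x" "b \<in> nbrs V x" "a \<noteq> b" "reach (V - {x}) adj a b"
    and "a' \<in> nbrs V x" "b' \<in> nbrs V x" "a' \<noteq> b'" "reach (V - {x}) adj a' b'"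
  shows "{a, b} = {a', b'}"
proof -
  let ?f = "\<lambda>w. comp_rel (V - {x}) `` {w}"
  \<comment> \<open>As \<open>b\<close> has the class of \<open>a\<close>, leaving out
    \<open>a\<close> loses no class; the map is then injective on the other neighbours, and every
    colliding pair contains \<open>a\<close>.\<close>
  have key: "a \<in> {a', b'}"
    if ab: "a \<in> nbrs V x" "b \<in> nbrs V x" "a \<noteq> b" "reach (V - {x}) adj a b" for a b
  proof -
    have "?f a = ?f b" using same_class_iff ab by blast
    then have "?f ` nbrs V x = ?f ` (nbrs V x - {a})" using ab by blast
    moreover have "card (nbrs V x) \<le> Suc (card (?f ` nbrs V x))"
      using dim_cycle_delete[OF assms(1)] assms(2) by simp
    moreover have "card (nbrs V x) = Suc (card (nbrs V x - {a}))"
      using card_Suc_Diff1[of "nbrs V x" a] ab by simp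
    ultimately have "card (nbrs V x - {a}) \<le> card (?f ` (nbrs V x - {a}))" by simp
    then have "inj_on ?f (nbrs V x - {a})"
      by (meson card_image_le eq_card_imp_inj_on finite le_antisym)
    moreover have "?f a' = ?f b'" using same_class_iff assms by blast
    ultimately show ?thesis using assms(7-9) unfolding inj_on_def by blast
  qed
  from key[OF assms(3-6)] key[OF assms(4,3) assms(5)[symmetric] reach_sym[OF assms(6)]] assms(5)
  show ?thesis by auto
qed

text \<open>Once the neighbour \<open>c ! 1\<close> is left out, the map from neighbours to
  components is injective: a further collision would give a cycle through \<open>x\<close> that does
  not use the edge to \<open>c ! 1\<close>, hence a second cycle meeting \<open>c\<close>.\<close>

lemma dim_cycle_delete_unique_cycle:
  assumes "cycles_disjoint V adj" "x \<in> on_cycle V adj"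
  shows "dim_cycle V adj = dim_cycle (V - {x}) adj + 1"
proof -
  let ?f = "\<lambda>w. comp_rel (V - {x}) `` {w}"
  have x: "x \<in> V" using assms on_cycle_subset by auto
  obtain c where c: "is_cycle V adj c" "c ! 0 = x" using assms on_cycleE by blast
  have "inj_on ?f (nbrs V x - {c ! 1})"
  proof (rule inj_onI, rule ccontr)
    fix a b assume ab: "a \<in> nbrs V x - {c ! 1}" "b \<in> nbrs V x - {c ! 1}" "?f a = ?f b" "a \<noteq> b"
    then obtain c' where c': "is_cycle V adj c'" "c' ! 0 = x" "c' ! 1 = a" "last c' = b"
      using cycle_of_reach_nbrs same_class_iff x by (metis DiffD1)
    have "x \<in> set c \<inter> set c'"
      using c c' is_cycle_nonempty by (metis IntI length_greater_0_conv nth_mem)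
    then have "cycle_edges c = cycle_edges c'"
      using assms(1) c c' unfolding cycles_disjoint_def by blast
    then have "{{x, c ! 1}, {x, last c}} = {{x, a}, {x, b}}"
      using cycle_edges_at_hd[OF c(1)] cycle_edges_at_hd[OF c'(1)] c(2) c'(2-4) by simp
    then have "{x, c ! 1} \<in> {{x, a}, {x, b}}" by (metis insertI1)
    then show False using ab c by (auto simp: doubleton_eq_iff)
  qed
  then have "card (nbrs V x - {c ! 1}) = card (?f ` (nbrs V x - {c ! 1}))"
    by (simp add: card_image)
  also have "\<dots> \<le> card (?f ` nbrs V x)" by (intro card_mono) auto
  finally have "card (nbrs V x) \<le> Suc (card (?f ` nbrs V x))"
    using card_Suc_Diff1[of "nbrs V x" "c ! 1"] cycle_hd_nbrs(1)[OF c(1)] c(2) by simp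
  then show ?thesis
    using dim_cycle_delete[OF x] dim_cycle_delete_on_cycle[OF assms(2)] by linarith
qed

lemma dim_cycle_empty [simp]: "dim_cycle {} adj = 0"
  unfolding dim_cycle_def edge_set_def num_components_def by simp

section \<open>Graphs with disjoint cycles\<close>

lemma cycles_disjoint_mono: "cycles_disjoint W adj \<Longrightarrow> V \<subseteq> W \<Longrightarrow> cycles_disjoint V adj"
  unfolding cycles_disjoint_def using is_cycle_mono by blast

lemma cycles_disjointD:
  assumes "cycles_disjoint V adj" "is_cycle V adj c" "is_cycle V adj c'" "x \<in> set c" "x \<in> set c'"
  shows "cycle_edges c = cycle_edges c'" "set c = set c'"
proof -
  show "cycle_edges c = cycle_edges c'" using assms unfolding cycles_disjoint_def by blast
  then show "set c = set c'" by (simp add: set_eq_Union_cycle_edges)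
qed

text \<open>An edge \<open>uv\<close> of \<open>B\<close> on no cycle of \<open>B\<close> is a bridge; \<open>D\<close> is the side of \<open>u\<close>.\<close>
lemma bridge_partition:
  assumes uv: "u \<in> B" "v \<in> B" "adj u v"
    and no: "\<not> (\<exists>c. is_cycle B adj c \<and> u \<in> set c \<and> v \<in> set c)"
  obtains D where "D \<subseteq> B" "u \<in> D" "v \<notin> D"
    "\<And>a b. a \<in> D \<Longrightarrow> b \<in> B - D \<Longrightarrow> adj a b \<Longrightarrow> a = u \<and> b = v"
proof -
  define adj' where "adj' a b \<longleftrightarrow> adj a b \<and> {a, b} \<noteq> {u, v}" for a b
  define D where "D = {w \<in> B. reach B adj' u w}"
  have "\<not> reach B adj' u v"
  proof
    assume "reach B adj' u v"
    then obtain p where p: "p \<noteq> []" "hd p = u" "last p = v" "distinct p" "set p \<subseteq> B"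
      "successively adj' p" using distinct_path_of_reach uv(2) by metis
    have "successively adj p" using p(6) by (rule successively_mono) (simp add: adj'_def)
    moreover have "length p \<ge> 3"
    proof (rule ccontr)
      assume "\<not> length p \<ge> 3"
      then consider a where "p = [a]" | a b where "p = [a, b]"
        using p(1) by (cases p rule: remdups_adj.cases) (auto simp: not_le numeral_3_eq_3 less_Suc_eq)
      then show False
      proof cases
        case 1
        then show ?thesis using p uv(3) irrefl by auto
      next
        case 2
        then show ?thesis using p by (auto simp: adj'_def)
      qed
    qed
    ultimately have "is_cycle B adj p" using p uv(3) by (intro is_cycleI_path) (auto simp: adj_commute)
    then show False using no p by (metis hd_in_set last_in_set)
  qed
  then have v: "v \<notin> D" unfolding D_def by auto
  have u: "u \<in> D" using uv unfolding D_def reach_def by auto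
  have edge: "a = u \<and> b = v" if "a \<in> D" "b \<in> B - D" "adj a b" for a b
  proof -
    have "\<not> adj' a b"
    proof
      assume "adj' a b"
      then have "reach B adj' u b" using that unfolding D_def reach_def
        by (auto intro: rtranclp.rtrancl_into_rtrancl)
      then show False using that unfolding D_def by auto
    qed
    then have "{a, b} = {u, v}" using that unfolding adj'_def by auto
    then show ?thesis using that v by (auto simp: doubleton_eq_iff)
  qed
  show ?thesis using that[of D] u v edge unfolding D_def by blast
qed

text \<open>Ordered pairs, inner end first: each leaving edge is listed once, so the cardinality
  counts edges, and its ends stay distinguishable.\<close>

definition boundary :: "'a set \<Rightarrow> 'a set \<Rightarrow> ('a \<times> 'a) set" where
  "boundary V B = {(a, b). a \<in> B \<and> b \<in> V - B \<and> adj a b}"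

text \<open>A smallest nonempty vertex set \<open>B\<close> with at most one leaving edge contains no bridge,
  hence is a single vertex or a single cycle.\<close>
lemma low_degree_or_end_cycle:
  assumes dis: "cycles_disjoint V adj" and ne: "V \<noteq> {}"
  shows "(\<exists>x\<in>V. card (nbrs V x) \<le> 1) \<or>
    (\<exists>c. is_cycle V adj c \<and> card (boundary V (set c)) \<le> 1)"
proof -
  define P where "P B \<longleftrightarrow> B \<noteq> {} \<and> B \<subseteq> V \<and> card (boundary V B) \<le> 1" for B
  have "P V" unfolding P_def using ne by (simp add: boundary_def)
  then obtain B where B: "P B" and min: "\<And>D. P D \<Longrightarrow> card B \<le> card D"
    using ex_has_least_nat[of P V card] by blast
  have min': "\<not> P D" if "D \<subset> B" for D
    using min[of D] psubset_card_mono[of B D] that by auto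
  have small: "card X \<le> 1" if "X \<subseteq> {p}" for X and p :: "'a \<times> 'a"
    using card_mono[OF _ that] by simp
  \<comment> \<open>Otherwise the edge is a bridge splitting \<open>B\<close>. The at most one edge
    leaving \<open>B\<close> starts on one side only, so the other side is left by the bridge alone
    and contradicts minimality.\<close>
  have on_cyc: "\<exists>c. is_cycle B adj c \<and> u \<in> set c \<and> v \<in> set c"
    if uv: "u \<in> B" "v \<in> B" "adj u v" for u v
  proof (rule ccontr)
    assume "\<not> ?thesis"
    with uv obtain D where D: "D \<subseteq> B" "u \<in> D" "v \<notin> D"
      and e: "\<And>a b. a \<in> D \<Longrightarrow> b \<in> B - D \<Longrightarrow> adj a b \<Longrightarrow> a = u \<and> b = v"
      using bridge_partition by metis
    have "boundary V B = {} \<or> (\<exists>p. boundary V B = {p})"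
      using B unfolding P_def by (metis card_1_singletonE card_0_eq finite le_SucE le_zero_eq One_nat_def)
    then have "boundary V B \<inter> (D \<times> UNIV) = {} \<or> boundary V B \<inter> ((B - D) \<times> UNIV) = {}"
      by (elim disjE exE) auto
    then consider "boundary V B \<inter> (D \<times> UNIV) = {}" | "boundary V B \<inter> ((B - D) \<times> UNIV) = {}"
      by blast
    then show False
    proof cases
      case 1
      then have "boundary V D \<subseteq> {(u, v)}" using D e unfolding boundary_def by blast
      then have "P D" using small B D unfolding P_def by auto
      then show ?thesis using min'[of D] D uv by blast
    next
      case 2
      then have "boundary V (B - D) \<subseteq> {(v, u)}"
        using D e sym unfolding boundary_def by blast
      then have "P (B - D)" using small B D uv unfolding P_def by auto
      then show ?thesis using min'[of "B - D"] D uv by blast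
    qed
  qed
  show ?thesis
  proof (cases "\<exists>u\<in>B. \<exists>v\<in>B. adj u v")
    case False
    obtain x where x: "x \<in> B" using B unfolding P_def by auto
    have "(\<lambda>w. (x, w)) ` nbrs V x \<subseteq> boundary V B"
      using False x unfolding nbrs_def boundary_def by auto
    then have "card ((\<lambda>w. (x, w)) ` nbrs V x) \<le> card (boundary V B)" by (intro card_mono) auto
    also have "card ((\<lambda>w. (x, w)) ` nbrs V x) = card (nbrs V x)"
      by (intro card_image) (auto intro: inj_onI)
    finally have "x \<in> V" "card (nbrs V x) \<le> 1" using B x unfolding P_def by auto
    then show ?thesis by blast
  next
    case True
    then obtain c where c: "is_cycle B adj c" using on_cyc by blast
    have cV: "is_cycle V adj c" using c B is_cycle_mono unfolding P_def by blast
    have sub: "set c \<subseteq> B" using c unfolding is_cycle_def by auto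
    \<comment> \<open>A smaller cycle is left by at least two edges, so one of them stays in
      \<open>B\<close>. A cycle through that edge meets \<open>c\<close> without having its
      vertices, against disjointness.\<close>
    have "set c = B"
    proof (rule ccontr)
      assume neq: "set c \<noteq> B"
      have "\<not> P (set c)" using min' sub neq by blast
      then have "\<not> card (boundary V (set c)) \<le> 1"
        using c sub B is_cycle_nonempty unfolding P_def by auto
      then have "\<not> boundary V (set c) \<subseteq> boundary V B"
        using B card_mono[of "boundary V B"] unfolding P_def by (meson finite le_trans)
      then obtain a b where ab: "a \<in> set c" "b \<in> B" "b \<notin> set c" "adj a b"
        unfolding boundary_def using sub by blast
      then obtain c' where c': "is_cycle B adj c'" "a \<in> set c'" "b \<in> set c'"
        using on_cyc[of a b] sub by auto
      then have "set c = set c'"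
        using cycles_disjointD(2)[OF dis cV] ab B is_cycle_mono unfolding P_def by blast
      then show False using c' ab by auto
    qed
    then show ?thesis using cV B unfolding P_def by auto
  qed
qed

lemma acyclic_low_degree:
  assumes "on_cycle V adj = {}" "V \<noteq> {}"
  obtains x where "x \<in> V" "card (nbrs V x) \<le> 1"
proof -
  have no: "\<not> is_cycle V adj c" for c
  proof
    assume c: "is_cycle V adj c"
    then have "hd c \<in> on_cycle V adj" using is_cycle_nonempty[OF c] unfolding on_cycle_def
      by (auto intro: hd_in_set)
    then show False using assms by auto
  qed
  then have "cycles_disjoint V adj" unfolding cycles_disjoint_def by blast
  then show ?thesis using low_degree_or_end_cycle assms no that by blast
qed

text \<open>If two cycles sharing a vertex also share both edges at every common vertex, then
  the common vertices form a closed walk and the cycles coincide.\<close>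
lemma cycles_disjointI:
  assumes dim: "\<And>x. x \<in> on_cycle V adj \<Longrightarrow> dim_cycle V adj \<le> dim_cycle (V - {x}) adj + 1"
  shows "cycles_disjoint V adj"
proof -
  have at: "{e \<in> cycle_edges c1. x \<in> e} = {e \<in> cycle_edges c2. x \<in> e}"
    if c: "is_cycle V adj c1" "is_cycle V adj c2" "x \<in> set c1" "x \<in> set c2" for c1 c2 x
  proof -
    obtain m1 where m1: "rotate m1 c1 ! 0 = x" using obtain_rotation[OF c(3)] .
    obtain m2 where m2: "rotate m2 c2 ! 0 = x" using obtain_rotation[OF c(4)] .
    let ?d1 = "rotate m1 c1" and ?d2 = "rotate m2 c2"
    have d: "is_cycle V adj ?d1" "is_cycle V adj ?d2" using c is_cycle_rotate by blast+
    have x: "x \<in> on_cycle V adj" "x \<in> V" using c unfolding on_cycle_def is_cycle_def by auto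
    have "{?d1 ! 1, last ?d1} = {?d2 ! 1, last ?d2}"
      using cycle_nbrs_unique[OF x(2) dim[OF x(1)]] cycle_hd_nbrs[OF d(1)] cycle_hd_nbrs[OF d(2)]
      unfolding m1 m2 by blast
    then have "{{x, ?d1 ! 1}, {x, last ?d1}} = {{x, ?d2 ! 1}, {x, last ?d2}}"
      by (auto simp: doubleton_eq_iff)
    then have "{e \<in> cycle_edges ?d1. x \<in> e} = {e \<in> cycle_edges ?d2. x \<in> e}"
      using cycle_edges_at_hd[OF d(1)] cycle_edges_at_hd[OF d(2)] unfolding m1 m2 by simp
    then show ?thesis by (simp only: cycle_edges_rotate)
  qed
  have sub: "cycle_edges c1 \<subseteq> cycle_edges c2"
    if c: "is_cycle V adj c1" "is_cycle V adj c2" "x \<in> set c1" "x \<in> set c2" for c1 c2 x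
  proof -
    obtain m where m: "rotate m c1 ! 0 = x" using obtain_rotation[OF c(3)] .
    let ?d = "rotate m c1"
    let ?k = "length ?d"
    have d: "is_cycle V adj ?d" using c is_cycle_rotate by blast
    have e: "{?d ! i, ?d ! (Suc i mod ?k)} \<in> cycle_edges ?d" if "i < ?k" for i
      using that unfolding cycle_edges_def by blast
    have step: "{?d ! i, ?d ! (Suc i mod ?k)} \<in> cycle_edges c2"
      if "i < ?k" "?d ! i \<in> set c2" for i
    proof -
      have "?d ! i \<in> set ?d" using that(1) nth_mem by blast
      then have "{e \<in> cycle_edges ?d. ?d ! i \<in> e} = {e \<in> cycle_edges c2. ?d ! i \<in> e}"
        using at[OF d c(2)] that(2) by blast
      then show ?thesis using e[OF that(1)] by blast
    qed
    have all: "?d ! i \<in> set c2" if "i < ?k" for i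
      using that
    proof (induction i)
      case 0
      then show ?case using m c(4) by simp
    next
      case (Suc i)
      then have "{?d ! i, ?d ! Suc i} \<in> cycle_edges c2" using step[of i] by simp
      then show ?case using set_eq_Union_cycle_edges[of c2] by blast
    qed
    have "cycle_edges ?d \<subseteq> cycle_edges c2"
      using step all unfolding cycle_edges_def[of ?d] by blast
    then show ?thesis by (simp only: cycle_edges_rotate)
  qed
  show ?thesis
    unfolding cycles_disjoint_def using sub by (meson disjoint_iff subset_antisym)
qed

text \<open>A chord from position 0 to \<open>j\<close> closes the initial segment to a shorter
  cycle meeting \<open>c\<close>; disjointness would give both the same vertices.\<close>

lemma chordless_cycle:
  assumes dis: "cycles_disjoint V adj" and c: "is_cycle V adj c"
    and j: "j < length c" and chord: "adj (c ! 0) (c ! j)"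
  shows "j = 1 \<or> j = length c - 1"
proof (rule ccontr)
  assume neg: "\<not> ?thesis"
  have "j \<noteq> 0" using chord irrefl by metis
  then have j2: "2 \<le> j" "Suc j < length c" using neg j by auto
  let ?p = "take (Suc j) c"
  have cc: "distinct c" "set c \<subseteq> V" using c unfolding is_cycle_def by auto
  have "is_cycle V adj ?p"
  proof (rule is_cycleI_path)
    show "set ?p \<subseteq> V" using cc set_take_subset by fast
    show "successively adj ?p"
      using is_cycle_successively[OF c] by (simp add: successively_conv_nth)
    have "last ?p = c ! j" "hd ?p = c ! 0"
      using j by (simp add: take_Suc_conv_app_nth, cases c) auto
    then show "adj (last ?p) (hd ?p)" using chord sym by simp
  qed (use cc j2 in auto)
  moreover have "c ! 0 \<in> set c" "c ! 0 \<in> set ?p" using j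
    by (auto simp: in_set_conv_nth intro!: exI[of _ 0])
  ultimately have "set c = set ?p" using cycles_disjointD(2)[OF dis c] by blast
  then have "card (set c) = card (set ?p)" by simp
  then show False using cc j2 by (simp add: distinct_card)
qed

lemma cycle_closed:
  assumes c: "is_cycle V adj c" and x: "x \<in> set c" "x \<in> A"
    and cl: "\<And>a b. a \<in> A \<Longrightarrow> b \<in> V \<Longrightarrow> adj a b \<Longrightarrow> b \<in> A"
  shows "set c \<subseteq> A"
proof -
  obtain m where m: "rotate m c ! 0 = x" using obtain_rotation[OF x(1)] .
  let ?d = "rotate m c"
  have d: "is_cycle V adj ?d" using c is_cycle_rotate by blast
  have "?d ! i \<in> A" if "i < length ?d" for i
    using that
  proof (induction i)
    case 0
    then show ?case using m x by simp
  next
    case (Suc i)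
    then have "adj (?d ! i) (?d ! Suc i)" using d unfolding is_cycle_def
      by (metis Suc_lessD mod_less)
    moreover have "?d ! Suc i \<in> V" using d Suc.prems unfolding is_cycle_def
      by (meson nth_mem subsetD)
    ultimately show ?case using Suc cl by simp
  qed
  then have "set ?d \<subseteq> A" by (metis in_set_conv_nth subsetI)
  then show ?thesis by simp
qed

section \<open>Independence number and deletion\<close>

lemma indep_num_singleton: "indep_num {x} adj = 1"
proof (rule antisym)
  show "indep_num {x} adj \<le> 1" using indep_num_le_card[of "{x}" adj] by simp
  have "independent_set {x} adj {x}" using irrefl by (simp add: independent_set_def)
  then show "1 \<le> indep_num {x} adj" using indep_num_ge[of "{x}" adj "{x}"] by simp
qed

lemma indep_num_isolated:
  assumes "x \<in> V" "nbrs V x = {}"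
  shows "indep_num V adj = indep_num (V - {x}) adj + 1"
proof -
  have "indep_num ((V - {x}) \<union> {x}) adj = indep_num (V - {x}) adj + indep_num {x} adj"
    using assms sym unfolding nbrs_def by (intro indep_num_Un_nonadj) auto
  moreover have "(V - {x}) \<union> {x} = V" using assms by auto
  ultimately show ?thesis by (simp add: indep_num_singleton)
qed

text \<open>An independent set has at most one of \<open>x\<close>, \<open>y\<close>, and
  \<open>x\<close> can be added to any independent set that avoids both.\<close>

lemma indep_num_pendant:
  assumes x: "x \<in> V" and y: "nbrs V x = {y}"
  shows "indep_num V adj = indep_num (V - {x, y}) adj + 1"
proof (rule antisym)
  have adj: "adj x y" "y \<in> V" "x \<noteq> y" using y irrefl unfolding nbrs_def by auto
  have "indep_num {x, y} adj \<le> 1"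
  proof (rule indep_num_leI)
    fix T assume T: "independent_set {x, y} adj T"
    then have "\<not> {x, y} \<subseteq> T" using adj unfolding independent_set_def by auto
    then have "T \<subseteq> {x} \<or> T \<subseteq> {y}" using T unfolding independent_set_def by blast
    then show "card T \<le> 1" by (metis card.empty card.insert card_mono empty_iff finite One_nat_def)
  qed simp
  moreover have "indep_num V adj \<le> indep_num ((V - {x, y}) \<union> {x, y}) adj"
    by (intro indep_num_mono) auto
  ultimately show "indep_num V adj \<le> indep_num (V - {x, y}) adj + 1"
    using indep_num_Un_le[of "V - {x, y}" "{x, y}" adj] by simp
  have "indep_num ((V - {x, y}) \<union> {x}) adj = indep_num (V - {x, y}) adj + indep_num {x} adj"
    using y sym unfolding nbrs_def by (intro indep_num_Un_nonadj) auto
  moreover have "indep_num ((V - {x, y}) \<union> {x}) adj \<le> indep_num V adj"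
    using x by (intro indep_num_mono) auto
  ultimately show "indep_num (V - {x, y}) adj + 1 \<le> indep_num V adj"
    by (simp add: indep_num_singleton)
qed

lemma small_nbrs_cases:
  assumes "card (nbrs V x) \<le> 1"
  obtains "nbrs V x = {}" | y where "nbrs V x = {y}"
proof (cases "nbrs V x = {}")
  case False
  then have "card (nbrs V x) = 1" using assms card_0_eq[of "nbrs V x"] by (simp add: le_Suc_eq)
  then show ?thesis using that by (metis card_1_singletonE)
qed (use that in blast)

lemma card_delete: "x \<in> V \<Longrightarrow> int (card V) = int (card (V - {x})) + 1" for V :: "'a set"
  using card_Suc_Diff1[of V x] by simp

lemma indep_num_delete_le: "indep_num (V - {x}) adj \<le> indep_num V adj"
  by (intro indep_num_mono) auto

text \<open>A cycle inside would share a vertex with \<open>c\<close>, hence have all its vertices,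
  including \<open>x\<close>. So the formulas for forests apply to a cycle minus a vertex.\<close>

lemma cycle_set_delete_acyclic:
  assumes dis: "cycles_disjoint V adj" and c: "is_cycle V adj c" and x: "x \<in> set c"
  shows "on_cycle (set c - {x}) adj = {}"
proof -
  have "\<not> is_cycle (set c - {x}) adj c'" for c'
  proof
    assume c': "is_cycle (set c - {x}) adj c'"
    then have sub: "set c' \<subseteq> set c - {x}" "c' \<noteq> []" by (auto simp: is_cycle_def)
    moreover have "is_cycle V adj c'" using c' c is_cycle_mono unfolding is_cycle_def by blast
    ultimately have "set c = set c'"
      using cycles_disjointD(2)[OF dis c, of c' "hd c'"] by (meson DiffD1 hd_in_set subsetD)
    then show False using sub x by auto
  qed
  then show ?thesis unfolding on_cycle_def by auto
qed

text \<open>Shifting an independent set by one step along the cycle gives a disjoint set.\<close>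
lemma indep_num_cycle:
  assumes c: "is_cycle V adj c"
  shows "2 * indep_num (set c) adj \<le> length c"
proof -
  obtain T where T: "independent_set (set c) adj T" "card T = indep_num (set c) adj"
    using indep_num_attained by blast
  let ?k = "length c"
  have cc: "distinct c" "?k > 0" using c unfolding is_cycle_def by auto
  define J where "J = {i. i < ?k \<and> c ! i \<in> T}"
  define J' where "J' = (\<lambda>i. (1 + i) mod ?k) ` J"
  have J: "J \<subseteq> {..<?k}" unfolding J_def by auto
  have inj: "inj_on (\<lambda>i. (1 + i) mod ?k) {..<?k}"
    using bij_betw_shift_mod[OF cc(2), of 1] by (simp add: bij_betw_def)
  have "T = (!) c ` J"
  proof (intro equalityI subsetI)
    fix x assume x: "x \<in> T"
    then have "x \<in> set c" using T(1) unfolding independent_set_def by auto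
    then obtain i where "i < ?k" "x = c ! i" by (metis in_set_conv_nth)
    then show "x \<in> (!) c ` J" using x unfolding J_def by auto
  qed (auto simp: J_def)
  moreover have "inj_on ((!) c) J"
    using cc J by (intro inj_on_nth) auto
  ultimately have "card T = card J" by (simp add: card_image)
  moreover have "card J' = card J"
    unfolding J'_def using inj J by (meson card_image inj_on_subset)
  moreover have "J \<inter> J' = {}"
  proof -
    have False if i: "i \<in> J" "Suc i mod ?k \<in> J" for i
      using T(1) i c unfolding independent_set_def J_def is_cycle_def by blast
    then show ?thesis unfolding J'_def by auto
  qed
  moreover have "card (J \<union> J') \<le> card {..<?k}"
    using J cc unfolding J'_def by (intro card_mono) auto
  moreover have "finite J" "finite J'" using J finite_subset unfolding J'_def by blast+
  ultimately show ?thesis using T(2) by (simp add: card_Un_disjoint)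
qed

lemma dim_cycle_forest: "on_cycle F adj = {} \<Longrightarrow> dim_cycle F adj = 0"
  using finite[of F]
proof (induction F rule: finite_psubset_induct)
  case (psubset F)
  show ?case
  proof (cases "F = {}")
    case False
    then obtain x where x: "x \<in> F" by auto
    then have "dim_cycle (F - {x}) adj = 0"
      using psubset on_cycle_mono[of "F - {x}" F] by auto
    then show ?thesis using dim_cycle_delete_not_on_cycle[OF x] psubset.prems by simp
  qed simp
qed

text \<open>Chordlessness leaves only the two cycle neighbours. The vertex is written with index
  \<open>Suc i\<close>, so that predecessor and successor need no subtraction.\<close>

lemma cycle_nbrs:
  assumes dis: "cycles_disjoint V adj" and c: "is_cycle V adj c" and i: "i < length c"
  shows "{w \<in> set c. adj (c ! (Suc i mod length c)) w} = {c ! i, c ! (Suc (Suc i) mod length c)}"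
    and "c ! i \<noteq> c ! (Suc (Suc i) mod length c)"
proof -
  let ?k = "length c"
  let ?b = "c ! (Suc i mod ?k)"
  have k: "?k \<ge> 3" "distinct c" using c unfolding is_cycle_def by auto
  have a: "\<And>i. i < ?k \<Longrightarrow> adj (c ! i) (c ! (Suc i mod ?k))" using c by (auto simp: is_cycle_def)
  have m: "Suc i mod ?k < ?k" "Suc (Suc i) mod ?k < ?k"
    using k by (auto intro!: mod_less_divisor)
  have "Suc i + (?k - 1) = i + ?k" using k by linarith
  then have last: "(Suc i + (?k - 1)) mod ?k = i" using i by simp
  have sub: "w = c ! i \<or> w = c ! (Suc (Suc i) mod ?k)" if w: "w \<in> set c" "adj ?b w" for w
  proof -
    let ?d = "rotate (Suc i) c"
    have d: "is_cycle V adj ?d" using c is_cycle_rotate by blast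
    have nth: "?d ! j = c ! ((Suc i + j) mod ?k)" if "j < ?k" for j
      using that by (rule nth_rotate)
    have "w \<in> set ?d" using w by simp
    then obtain j where j: "j < ?k" "?d ! j = w" by (metis in_set_conv_nth length_rotate)
    have "?d ! 0 = ?b" 
      using nth[of 0] k by (metis add.right_neutral gr_zeroI not_numeral_le_zero)
    then have "j = 1 \<or> j = ?k - 1"
      using chordless_cycle[OF dis d, of j] j w by simp
    then show ?thesis using nth[OF j(1)] j(2) last by auto
  qed
  have "adj ?b (c ! i)" using a[OF i] sym by blast
  moreover have "adj ?b (c ! (Suc (Suc i) mod ?k))"
    using a[OF m(1)] by (simp add: mod_Suc_eq)
  ultimately show "{w \<in> set c. adj ?b w} = {c ! i, c ! (Suc (Suc i) mod ?k)}"
    using sub i m by auto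
  \<comment> \<open>A cycle has length at least 3, so predecessor and successor differ.\<close>
  have "i \<noteq> Suc (Suc i) mod ?k"
  proof (cases "Suc (Suc i) < ?k")
    case False
    then have "Suc (Suc i) mod ?k = Suc (Suc i) - ?k" using i k by (simp add: mod_if)
    moreover have "i \<noteq> Suc (Suc i) - ?k" using k i False by linarith
    ultimately show ?thesis by simp
  qed simp
  then show "c ! i \<noteq> c ! (Suc (Suc i) mod ?k)"
    using k i m by (simp add: nth_eq_iff_index_eq)
qed

section \<open>Condition (iii) and contraction of the cycles\<close>

definition cycles_nonadjacent :: "'a set \<Rightarrow> bool" where
  "cycles_nonadjacent V \<longleftrightarrow> (\<forall>c1 c2. is_cycle V adj c1 \<and> is_cycle V adj c2 \<and> set c1 \<noteq> set c2 \<longrightarrow>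
    (\<forall>a\<in>set c1. \<forall>b\<in>set c2. \<not> adj a b))"

text \<open>The maximum independent sets of Gamma that, in the contraction, have no contracted cycle
  as neighbour.\<close>

definition avoiding_max :: "'a set \<Rightarrow> 'a set \<Rightarrow> bool" where
  "avoiding_max V I \<longleftrightarrow> independent_set (Gamma_V V adj) adj I \<and>
    card I = indep_num (Gamma_V V adj) adj \<and> (\<forall>i\<in>I. \<forall>w\<in>on_cycle V adj. \<not> adj i w)"

text \<open>Reformulation of condition (iii) on the contracted graph \<open>T\<^sub>G\<close>.\<close>
definition separated :: "'a set \<Rightarrow> bool" where
  "separated V \<longleftrightarrow> cycles_nonadjacent V \<and> (\<exists>I. avoiding_max V I)"

text \<open>The avoiding set can be joined to a maximum independent set of the cycle vertices. This
  transfers changes of the independence number between a graph and its Gamma while the cycle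
  vertices stay the same.\<close>

lemma indep_num_separated:
  assumes "separated V"
  shows "indep_num V adj = indep_num (Gamma_V V adj) adj + indep_num (on_cycle V adj) adj"
proof (rule antisym)
  have V: "Gamma_V V adj \<union> on_cycle V adj = V"
    using on_cycle_subset unfolding Gamma_V_def by auto
  show "indep_num V adj \<le> indep_num (Gamma_V V adj) adj + indep_num (on_cycle V adj) adj"
    using indep_num_Un_le[of "Gamma_V V adj" "on_cycle V adj" adj] V by simp
  obtain I where I: "avoiding_max V I" using assms unfolding separated_def by auto
  obtain J where J: "independent_set (on_cycle V adj) adj J"
    "card J = indep_num (on_cycle V adj) adj"
    using indep_num_attained[of "on_cycle V adj" adj] by auto
  have "independent_set V adj (I \<union> J)"
    unfolding independent_set_def
  proof (intro conjI ballI)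
    show "I \<union> J \<subseteq> V" using I J(1) V unfolding avoiding_max_def independent_set_def by blast
    fix a b assume "a \<in> I \<union> J" "b \<in> I \<union> J"
    then show "\<not> adj a b"
      using I J(1) adj_commute[of a b] unfolding avoiding_max_def independent_set_def by blast
  qed
  moreover have "card (I \<union> J) = card I + card J"
    using I J(1) unfolding avoiding_max_def independent_set_def Gamma_V_def
    by (intro card_Un_disjoint) auto
  ultimately show "indep_num (Gamma_V V adj) adj + indep_num (on_cycle V adj) adj \<le> indep_num V adj"
    using I J(2) indep_num_ge[of V adj "I \<union> J"] unfolding avoiding_max_def by simp
qed

section \<open>Deleting vertices that lie on no cycle\<close>

lemma is_cycle_delete_iff:
  assumes "A \<inter> on_cycle V adj = {}"
  shows "is_cycle (V - A) adj c \<longleftrightarrow> is_cycle V adj c"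
proof
  assume c: "is_cycle V adj c"
  then have "set c \<subseteq> on_cycle V adj" "set c \<subseteq> V" unfolding on_cycle_def is_cycle_def by auto
  then show "is_cycle (V - A) adj c" using c assms by (intro is_cycle_restrict[OF c]) auto
qed (use is_cycle_mono in blast)

lemma on_cycle_delete:
  assumes "A \<inter> on_cycle V adj = {}"
  shows "on_cycle (V - A) adj = on_cycle V adj" "Gamma_V (V - A) adj = Gamma_V V adj - A"
  using is_cycle_delete_iff[OF assms] unfolding Gamma_V_def on_cycle_def by auto

lemma cycle_properties_delete:
  assumes "A \<inter> on_cycle V adj = {}"
  shows "cycles_disjoint (V - A) adj \<longleftrightarrow> cycles_disjoint V adj"
    "cycles_nonadjacent (V - A) \<longleftrightarrow> cycles_nonadjacent V"
  unfolding cycles_disjoint_def cycles_nonadjacent_def is_cycle_delete_iff[OF assms]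
  by simp_all

text \<open>Common core of the isolated case \<open>A = {x}\<close> and the pendant case
  \<open>A = {x, y}\<close>: removing \<open>A\<close> costs an avoiding set at most one element,
  and conversely \<open>x\<close> can always be added.\<close>

lemma separated_delete_iff:
  assumes A: "A \<inter> on_cycle V adj = {}" "x \<in> A" "A \<subseteq> V"
    and nb: "nbrs V x \<subseteq> A"
    and one: "indep_num A adj \<le> 1"
    and \<Gamma>: "indep_num (Gamma_V V adj) adj = indep_num (Gamma_V V adj - A) adj + 1"
  shows "separated V \<longleftrightarrow> separated (V - A)"
proof
  assume "separated V"
  then obtain I where I: "avoiding_max V I" and na: "cycles_nonadjacent V"
    unfolding separated_def by auto
  have ind: "independent_set (Gamma_V V adj - A) adj (I - A)" "independent_set A adj (I \<inter> A)"
    using I unfolding avoiding_max_def independent_set_def by auto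
  have "card I = card (I \<inter> A) + card (I - A)" by (simp add: card_Int_Diff)
  moreover have "card (I \<inter> A) \<le> 1" using indep_num_ge[OF _ ind(2)] one by simp
  moreover have "card (I - A) \<le> indep_num (Gamma_V V adj - A) adj"
    using indep_num_ge[OF _ ind(1)] by simp
  ultimately have "card (I - A) = indep_num (Gamma_V V adj - A) adj"
    using I \<Gamma> unfolding avoiding_max_def by simp
  then have "avoiding_max (V - A) (I - A)"
    using I ind(1) unfolding avoiding_max_def on_cycle_delete[OF A(1)] by auto
  then show "separated (V - A)"
    using na cycle_properties_delete(2)[OF A(1)] unfolding separated_def by auto
next
  assume "separated (V - A)"
  then obtain I where I: "avoiding_max (V - A) I" and na: "cycles_nonadjacent (V - A)"
    unfolding separated_def by auto
  have I': "independent_set (Gamma_V V adj - A) adj I" "card I = indep_num (Gamma_V V adj - A) adj"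
    "\<forall>i\<in>I. \<forall>w\<in>on_cycle V adj. \<not> adj i w"
    using I unfolding avoiding_max_def on_cycle_delete[OF A(1)] by auto
  have nx: "\<not> adj x w" if "w \<in> V" "w \<notin> A" for w using nb that unfolding nbrs_def by auto
  have "Gamma_V V adj - A \<subseteq> V" unfolding Gamma_V_def by auto
  then have "I \<subseteq> V - A" using I'(1) unfolding independent_set_def by auto
  have "independent_set (Gamma_V V adj) adj (insert x I)"
    unfolding independent_set_def
  proof (intro conjI ballI)
    show "insert x I \<subseteq> Gamma_V V adj"
      using A I'(1) unfolding independent_set_def Gamma_V_def by auto
    fix a b assume "a \<in> insert x I" "b \<in> insert x I"
    then show "\<not> adj a b"
      using I'(1) nx \<open>I \<subseteq> V - A\<close> irrefl adj_commute[of a b] unfolding independent_set_def by auto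
  qed
  moreover have "card (insert x I) = indep_num (Gamma_V V adj) adj"
    using \<Gamma> I'(2) \<open>I \<subseteq> V - A\<close> A(2) by (subst card_insert_disjoint) auto
  moreover have "\<not> adj i w" if "i \<in> insert x I" "w \<in> on_cycle V adj" for i w
    using that I'(3) nx[of w] A(1) on_cycle_subset by auto
  ultimately have "avoiding_max V (insert x I)" unfolding avoiding_max_def by blast
  then show "separated V"
    using na cycle_properties_delete(2)[OF A(1)] unfolding separated_def by auto
qed

lemma separated_isolated_iff:
  assumes "x \<in> V" "nbrs V x = {}"
  shows "separated V \<longleftrightarrow> separated (V - {x})"
proof (rule separated_delete_iff)
  have x: "x \<notin> on_cycle V adj" using assms low_degree_not_on_cycle[of V x] by simp
  then show "{x} \<inter> on_cycle V adj = {}" by simp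
  have "x \<in> Gamma_V V adj" "nbrs (Gamma_V V adj) x = {}"
    using assms x unfolding Gamma_V_def nbrs_def by auto
  then show "indep_num (Gamma_V V adj) adj = indep_num (Gamma_V V adj - {x}) adj + 1"
    by (rule indep_num_isolated)
  show "indep_num {x} adj \<le> 1" by (simp add: indep_num_singleton)
qed (use assms in auto)

lemma separated_pendant_iff:
  assumes "x \<in> V" "nbrs V x = {y}" "y \<notin> on_cycle V adj"
  shows "separated V \<longleftrightarrow> separated (V - {x, y})"
proof (rule separated_delete_iff)
  have x: "x \<notin> on_cycle V adj" using assms low_degree_not_on_cycle[of V x] by simp
  then show "{x, y} \<inter> on_cycle V adj = {}" using assms by simp
  have "x \<in> Gamma_V V adj" "nbrs (Gamma_V V adj) x = {y}"
    using assms x unfolding Gamma_V_def nbrs_def by auto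
  then show "indep_num (Gamma_V V adj) adj = indep_num (Gamma_V V adj - {x, y}) adj + 1"
    by (rule indep_num_pendant)
  have "nbrs {x, y} x = {y}" using assms(2) irrefl unfolding nbrs_def by auto
  then show "indep_num {x, y} adj \<le> 1" using indep_num_pendant[of x "{x, y}" y] by simp
qed (use assms in \<open>auto simp: nbrs_def\<close>)

text \<open>If \<open>y\<close> were on a cycle, the avoiding set would miss \<open>x\<close>, while
  \<open>x\<close> would be isolated in Gamma; adding \<open>x\<close> would then beat the
  maximum.\<close>

lemma separated_pendant_not_on_cycle:
  assumes "separated V" "x \<in> V" "nbrs V x = {y}"
  shows "y \<notin> on_cycle V adj"
proof
  assume y: "y \<in> on_cycle V adj"
  obtain I where I: "avoiding_max V I" using assms unfolding separated_def by auto
  have x: "x \<notin> on_cycle V adj" using assms low_degree_not_on_cycle[of V x] by simp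
  have "adj x y" using assms(3) unfolding nbrs_def by auto
  then have "x \<notin> I" using I y unfolding avoiding_max_def by auto
  have nx: "\<not> adj x w" if "w \<in> Gamma_V V adj" for w
    using that assms(3) y unfolding Gamma_V_def nbrs_def by auto
  have "independent_set (Gamma_V V adj) adj (insert x I)"
    unfolding independent_set_def
  proof (intro conjI ballI)
    show "insert x I \<subseteq> Gamma_V V adj"
      using I x assms(2) unfolding avoiding_max_def independent_set_def Gamma_V_def by auto
    then show "\<not> adj a b" if "a \<in> insert x I" "b \<in> insert x I" for a b
      using that I nx adj_commute[of a b] unfolding avoiding_max_def independent_set_def by auto
  qed
  then have "card (insert x I) \<le> card I"
    using indep_num_ge[of "Gamma_V V adj"] I unfolding avoiding_max_def by simp
  then show False using \<open>x \<notin> I\<close> by (simp add: card_insert_disjoint)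
qed

section \<open>Deleting all vertices of one cycle\<close>

lemma is_cycle_delete_cycle_iff:
  assumes dis: "cycles_disjoint V adj" and c: "is_cycle V adj c"
  shows "is_cycle (V - set c) adj c' \<longleftrightarrow> is_cycle V adj c' \<and> set c' \<noteq> set c"
proof
  assume c': "is_cycle (V - set c) adj c'"
  then have "set c' \<inter> set c = {}" "set c' \<noteq> {}" unfolding is_cycle_def by auto
  then show "is_cycle V adj c' \<and> set c' \<noteq> set c"
    using is_cycle_mono[OF c', of V] by auto
next
  assume c': "is_cycle V adj c' \<and> set c' \<noteq> set c"
  then have "set c' \<inter> set c = {}" using cycles_disjointD(2)[OF dis, of c' c] c by blast
  then show "is_cycle (V - set c) adj c'"
    using c' is_cycle_restrict[of V adj c' "V - set c"] unfolding is_cycle_def by auto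
qed

lemma on_cycle_delete_cycle:
  assumes dis: "cycles_disjoint V adj" and c: "is_cycle V adj c"
  shows "on_cycle (V - set c) adj = on_cycle V adj - set c"
    and "Gamma_V (V - set c) adj = Gamma_V V adj"
proof -
  show *: "on_cycle (V - set c) adj = on_cycle V adj - set c"
  proof (intro equalityI subsetI)
    fix x assume "x \<in> on_cycle (V - set c) adj"
    then show "x \<in> on_cycle V adj - set c"
      using on_cycle_mono[of "V - set c" V] on_cycle_subset[of "V - set c"] by auto
  next
    fix x assume "x \<in> on_cycle V adj - set c"
    then obtain c' where "is_cycle V adj c'" "x \<in> set c'" "x \<notin> set c" unfolding on_cycle_def by auto
    then show "x \<in> on_cycle (V - set c) adj"
      using is_cycle_delete_cycle_iff[OF assms] unfolding on_cycle_def by auto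
  qed
  have "set c \<subseteq> on_cycle V adj" using c unfolding on_cycle_def by auto
  then show "Gamma_V (V - set c) adj = Gamma_V V adj" unfolding Gamma_V_def * by auto
qed

lemma boundary_cases:
  assumes "card (boundary V C) \<le> 1"
  obtains "boundary V C = {}" | x y where "boundary V C = {(x, y)}"
proof (cases "boundary V C = {}")
  case False
  then have "card (boundary V C) = 1"
    using assms card_0_eq[of "boundary V C"] by (simp add: le_Suc_eq)
  then show ?thesis using that by (metis card_1_singletonE surj_pair)
qed (use that in blast)

lemma cycles_nonadjacent_delete_cycle:
  assumes dis: "cycles_disjoint V adj" and c: "is_cycle V adj c"
    and out: "\<And>a b. (a, b) \<in> boundary V (set c) \<Longrightarrow> b \<notin> on_cycle V adj"
    and R: "cycles_nonadjacent (V - set c)"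
  shows "cycles_nonadjacent V"
  unfolding cycles_nonadjacent_def
proof (intro allI impI ballI)
  fix c1 c2 a b assume *: "is_cycle V adj c1 \<and> is_cycle V adj c2 \<and> set c1 \<noteq> set c2"
    and ab: "a \<in> set c1" "b \<in> set c2"
  have mem: "a \<in> V" "b \<in> V" "a \<in> on_cycle V adj" "b \<in> on_cycle V adj"
    using * ab unfolding is_cycle_def on_cycle_def by auto
  consider "set c1 = set c" | "set c2 = set c" | "set c1 \<noteq> set c" "set c2 \<noteq> set c" by blast
  then show "\<not> adj a b"
  proof cases
    case 1
    then have "b \<notin> set c" using * ab cycles_disjointD(2)[OF dis, of c2 c] c by blast
    then show ?thesis using out[of a b] mem ab 1 unfolding boundary_def by blast
  next
    case 2
    then have "a \<notin> set c" using * ab cycles_disjointD(2)[OF dis, of c1 c] c by blast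
    then show ?thesis using out[of b a] mem ab 2 sym unfolding boundary_def by blast
  next
    case 3
    then show ?thesis using R * ab is_cycle_delete_cycle_iff[OF dis c]
      unfolding cycles_nonadjacent_def by blast
  qed
qed

lemma separated_empty: "separated {}"
proof -
  have "\<not> is_cycle {} adj c" for c by (auto simp: is_cycle_def)
  then have "cycles_nonadjacent {}" "avoiding_max {} {}"
    unfolding cycles_nonadjacent_def avoiding_max_def
    by (auto simp: Gamma_V_def independent_set_def)
  then show ?thesis unfolding separated_def by blast
qed

text \<open>Deleting a cycle vertex lowers d by one and, by disjointness, removes exactly one cycle
  vertex set. So d counts the contracted vertices of \<open>T_V\<close>.\<close>

lemma dim_cycle_eq_card_cycles:
  "cycles_disjoint V adj \<Longrightarrow> dim_cycle V adj = int (card {set c | c. is_cycle V adj c})"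
  using finite[of V]
proof (induction V rule: finite_psubset_induct)
  case (psubset V)
  show ?case
  proof (cases "on_cycle V adj = {}")
    case True
    have "\<not> is_cycle V adj c" for c
    proof
      assume c: "is_cycle V adj c"
      then have "set c \<subseteq> on_cycle V adj" unfolding on_cycle_def by auto
      then show False using True is_cycle_nonempty[OF c] by simp
    qed
    then have "{set c | c. is_cycle V adj c} = {}" by blast
    then show ?thesis using dim_cycle_forest[OF True] by simp
  next
    case False
    then obtain x where x: "x \<in> on_cycle V adj" by auto
    then obtain c where c: "is_cycle V adj c" "x \<in> set c" unfolding on_cycle_def by auto
    have cyc: "is_cycle (V - {x}) adj c' \<longleftrightarrow> is_cycle V adj c' \<and> set c' \<noteq> set c" for c'
    proof
      assume c': "is_cycle (V - {x}) adj c'"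
      then have "x \<notin> set c'" unfolding is_cycle_def by auto
      then show "is_cycle V adj c' \<and> set c' \<noteq> set c"
        using c is_cycle_mono[OF c', of V] by auto
    next
      assume c': "is_cycle V adj c' \<and> set c' \<noteq> set c"
      then have "x \<notin> set c'" using cycles_disjointD(2)[OF psubset.prems, of c' c] c by blast
      then show "is_cycle (V - {x}) adj c'"
        using c' is_cycle_restrict[of V adj c' "V - {x}"] unfolding is_cycle_def by auto
    qed
    have "{set c | c. is_cycle V adj c} = insert (set c) {set c | c. is_cycle (V - {x}) adj c}"
      unfolding cyc using c by blast
    moreover have "set c \<notin> {set c | c. is_cycle (V - {x}) adj c}" unfolding cyc by auto
    ultimately have "card {set c | c. is_cycle V adj c}
      = Suc (card {set c | c. is_cycle (V - {x}) adj c})" by (simp add: card_insert_disjoint)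
    moreover have "dim_cycle (V - {x}) adj = int (card {set c | c. is_cycle (V - {x}) adj c})"
      using psubset x on_cycle_subset[of V] cycles_disjoint_mono[of V "V - {x}"] by blast
    ultimately show ?thesis using dim_cycle_delete_unique_cycle[OF psubset.prems x] by simp
  qed
qed

text \<open>The right-hand sum is always an upper bound. Equality forces a maximum independent set
  to contain every contracted cycle together with a maximum independent set of Gamma, and their
  joint independence is \<open>separated\<close>.\<close>

lemma indep_num_contraction_iff:
  "indep_num (T_V V adj) (T_adj adj) = indep_num (Gamma_V V adj) adj + card {set c | c. is_cycle V adj c}
    \<longleftrightarrow> separated V" (is "?l = ?g + card ?W \<longleftrightarrow> _")
proof -
  have T: "T_V V adj = Inl ` Gamma_V V adj \<union> Inr ` ?W"
    unfolding T_V_def Gamma_V_def by simp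
  have fin: "finite (T_V V adj)" unfolding T by simp
  have split: "Q = (Inl ` (Inl -` Q) \<union> Inr ` (Inr -` Q))" for Q :: "('a + 'a set) set"
    by (auto simp: image_iff) (metis sum.exhaust)
  have card_split: "card Q = card (Inl -` Q) + card (Inr -` Q)" for Q :: "('a + 'a set) set"
  proof -
    have "card Q = card (Inl -` Q <+> Inr -` Q)"
      unfolding Plus_def using split[of Q] by (rule arg_cong)
    then show ?thesis by (simp add: card_Plus)
  qed
  have part: "independent_set (Gamma_V V adj) adj (Inl -` Q)" "Inr -` Q \<subseteq> ?W"
    if "independent_set (T_V V adj) (T_adj adj) Q" for Q
    using that unfolding independent_set_def T by fastforce+
  have le: "card (Inl -` Q) \<le> ?g" "card (Inr -` Q) \<le> card ?W"
    if "independent_set (T_V V adj) (T_adj adj) Q" for Q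
    using part[OF that] indep_num_ge[of "Gamma_V V adj"] by (auto intro: card_mono)
  have upper: "?l \<le> ?g + card ?W"
    using fin le card_split by (intro indep_num_leI) (auto intro: add_mono)
  show ?thesis
  proof
    assume eq: "?l = ?g + card ?W"
    obtain Q where Q: "independent_set (T_V V adj) (T_adj adj) Q" "card Q = ?l"
      using indep_num_attained[OF fin, of "T_adj adj"] by auto
    have c: "card (Inl -` Q) = ?g" "card (Inr -` Q) = card ?W"
      using le[OF Q(1)] card_split[of Q] Q(2) eq by linarith+
    then have W: "Inr -` Q = ?W" using part(2)[OF Q(1)] by (intro card_subset_eq) auto
    have Q0: "\<not> T_adj adj p q" if "p \<in> Q" "q \<in> Q" for p q
      using Q(1) that unfolding independent_set_def by blast
    have inr: "Inr (set c') \<in> Q" if "is_cycle V adj c'" for c' using W that by blast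
    have "avoiding_max V (Inl -` Q)"
      unfolding avoiding_max_def
    proof (intro conjI ballI)
      fix i w assume i: "i \<in> Inl -` Q" and w: "w \<in> on_cycle V adj"
      obtain c' where c': "is_cycle V adj c'" "w \<in> set c'" using w unfolding on_cycle_def by auto
      have "\<not> T_adj adj (Inl i) (Inr (set c'))" using Q0[of "Inl i"] i inr[OF c'(1)] by blast
      then show "\<not> adj i w" using c'(2) by auto
    qed (use part(1)[OF Q(1)] c in auto)
    moreover have "cycles_nonadjacent V"
      unfolding cycles_nonadjacent_def
    proof (intro allI impI ballI)
      fix c1 c2 a b
      assume *: "is_cycle V adj c1 \<and> is_cycle V adj c2 \<and> set c1 \<noteq> set c2" "a \<in> set c1" "b \<in> set c2"
      then have "\<not> T_adj adj (Inr (set c1)) (Inr (set c2))" using Q0 inr by blast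
      then show "\<not> adj a b" using * by auto
    qed
    ultimately show "separated V" unfolding separated_def by blast
  next
    assume "separated V"
    then obtain I where I: "avoiding_max V I" and na: "cycles_nonadjacent V"
      unfolding separated_def by auto
    let ?Q = "Inl ` I \<union> Inr ` ?W"
    have I1: "I \<subseteq> Gamma_V V adj" using I unfolding avoiding_max_def independent_set_def by auto
    have I2: "\<not> adj i w" "\<not> adj w i" if "i \<in> I" "D \<in> ?W" "w \<in> D" for i w D
    proof -
      have "w \<in> on_cycle V adj" using that unfolding on_cycle_def by auto
      then show "\<not> adj i w" "\<not> adj w i" using I that sym unfolding avoiding_max_def by blast+
    qed
    have "independent_set (T_V V adj) (T_adj adj) ?Q"
      unfolding independent_set_def
    proof (intro conjI ballI)
      show "?Q \<subseteq> T_V V adj" unfolding T using I1 by auto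
      fix p q assume pq: "p \<in> ?Q" "q \<in> ?Q"
      show "\<not> T_adj adj p q"
      proof (cases p; cases q)
        fix i j assume "p = Inl i" "q = Inl j"
        then show ?thesis using pq I unfolding avoiding_max_def independent_set_def by auto
      next
        fix i D assume *: "p = Inl i" "q = Inr D"
        then have "i \<in> I" "D \<in> ?W" using pq by auto
        then show ?thesis using I2 * by auto
      next
        fix i D assume *: "p = Inr D" "q = Inl i"
        then have "i \<in> I" "D \<in> ?W" using pq by auto
        then show ?thesis using I2 * by auto
      next
        fix D E assume *: "p = Inr D" "q = Inr E"
        then have "D \<in> ?W" "E \<in> ?W" using pq by auto
        then show ?thesis using na * unfolding cycles_nonadjacent_def by auto
      qed
    qed
    then have "card ?Q \<le> ?l" using fin indep_num_ge by blast
    moreover have "card ?Q = card I + card ?W"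
      by (subst card_Un_disjoint) (auto simp: card_image)
    ultimately show "?l = ?g + card ?W" using upper I unfolding avoiding_max_def by simp
  qed
qed

end

section \<open>Kernels of skew-symmetric matrices\<close>

text \<open>The source of the exact change by one: before and after a vertex deletion, one null
  space is cut out of the other by a single linear condition.\<close>

lemma dim_kernel_functional:
  fixes K :: "'b::euclidean_space set" and \<phi> :: "'b \<Rightarrow> real"
  assumes K: "subspace K" and \<phi>: "linear \<phi>" and z: "z \<in> K" "\<phi> z \<noteq> 0"
  shows "dim K = dim {v \<in> K. \<phi> v = 0} + 1"
proof -
  let ?K0 = "{v \<in> K. \<phi> v = 0}"
  have sub: "subspace ?K0"
    using K \<phi> by (auto simp: subspace_def linear_0 linear_add linear_scale)
  have "z \<notin> span ?K0" using z sub by (metis (mono_tags, lifting) mem_Collect_eq span_eq_iff)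
  then have "dim (insert z ?K0) = dim ?K0 + 1" by (simp add: dim_insert)
  moreover have "span (insert z ?K0) = K"
  proof (rule span_unique)
    show "insert z ?K0 \<subseteq> K" using z by auto
    show "subspace K" by fact
    fix T assume T: "insert z ?K0 \<subseteq> T" "subspace T"
    show "K \<subseteq> T"
    proof
      fix v assume v: "v \<in> K"
      let ?w = "v - (\<phi> v / \<phi> z) *\<^sub>R z"
      have "?w \<in> ?K0" using v z K \<phi>
        by (auto simp: linear_diff linear_scale intro!: subspace_diff subspace_scale)
      then have "?w + (\<phi> v / \<phi> z) *\<^sub>R z \<in> T"
        using T by (intro subspace_add subspace_scale) auto
      then show "v \<in> T" by simp
    qed
  qed
  ultimately show ?thesis by (metis dim_span)
qed

text \<open>The orientation enters only through the signs in \<open>S\<close>. That entries on edges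
  are 1 or -1 is stated by squares, the form used for cancelling them.\<close>

locale skew_graph = finite_graph adj for adj :: "'a::finite \<Rightarrow> 'a \<Rightarrow> bool" +
  fixes S :: "real^'a^'a"
  assumes skew: "S $ i $ j = - S $ j $ i"
    and nonadj: "\<not> adj i j \<Longrightarrow> S $ i $ j = 0"
    and unit: "adj i j \<Longrightarrow> S $ i $ j * S $ i $ j = 1"
begin

lemma skew_inner: "inner u (S *v v) = - inner (S *v u) v"
proof -
  have "(u v* S) $ i = - ((S *v u) $ i)" for i
  proof -
    have "(u v* S) $ i = (\<Sum>j\<in>UNIV. S $ j $ i * u $ j)" by (simp add: vector_matrix_mult_def mult.commute)
    also have "\<dots> = (\<Sum>j\<in>UNIV. - (S $ i $ j * u $ j))"
      by (intro sum.cong refl) (metis skew mult_minus_left)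
    finally show ?thesis by (simp add: matrix_vector_mult_def sum_negf)
  qed
  then have "u v* S = - (S *v u)" by (simp add: vec_eq_iff)
  then show ?thesis using dot_lmul_matrix[of u S v] by simp
qed

lemma skew_inner_self: "inner u (S *v u) = 0"
  using skew_inner[of u u] by (simp add: inner_commute)

text \<open>The kernel of the principal submatrix on \<open>V\<close>, as vectors of the full space
  extended by 0.\<close>

definition null_space :: "'a set \<Rightarrow> (real^'a) set" where
  "null_space V = {v. (\<forall>i. i \<notin> V \<longrightarrow> v $ i = 0) \<and> (\<forall>i\<in>V. (S *v v) $ i = 0)}"

definition nullity :: "'a set \<Rightarrow> nat" where
  "nullity V = dim (null_space V)"

definition null_at :: "'a set \<Rightarrow> 'a \<Rightarrow> bool" where
  "null_at V x \<longleftrightarrow> (\<exists>v\<in>null_space V. v $ x \<noteq> 0)"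

lemma null_at_mem: "null_at V x \<Longrightarrow> x \<in> V"
  unfolding null_at_def null_space_def by auto

lemma subspace_null_space: "subspace (null_space V)"
  unfolding subspace_def null_space_def
  by (auto simp: matrix_vector_right_distrib matrix_vector_mult_scaleR)

lemma inner_eq_single:
  fixes u v :: "real^'a"
  assumes "\<And>i. i \<noteq> x \<Longrightarrow> u $ i * v $ i = 0"
  shows "inner u v = u $ x * v $ x"
proof -
  have "inner u v = (\<Sum>i\<in>UNIV. u $ i * v $ i)" by (simp add: inner_vec_def)
  also have "\<dots> = u $ x * v $ x + (\<Sum>i\<in>UNIV - {x}. u $ i * v $ i)"
    by (simp add: sum.remove)
  also have "(\<Sum>i\<in>UNIV - {x}. u $ i * v $ i) = 0" using assms by (intro sum.neutral) auto
  finally show ?thesis by simp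
qed

lemma inner_null_space:
  assumes "v \<in> null_space V" "\<And>i. i \<notin> V \<Longrightarrow> z $ i = 0"
  shows "inner z (S *v v) = 0"
proof -
  have "z $ i * (S *v v) $ i = 0" for i
    using assms unfolding null_space_def by (cases "i \<in> V") auto
  then show ?thesis unfolding inner_vec_def by (intro sum.neutral) simp
qed

lemma null_space_empty [simp]: "null_space {} = {0}"
  unfolding null_space_def by (auto simp: vec_eq_iff)

lemma nullity_empty [simp]: "nullity {} = 0"
  unfolding nullity_def by simp

text \<open>For \<open>z\<close> null on \<open>V - {x}\<close>, pairing \<open>S *v z\<close> with
  \<open>v\<close> leaves only the term at \<open>x\<close>, so row \<open>x\<close> vanishes on
  \<open>z\<close> too. Hence the smaller null space is the part of the larger one vanishing at
  \<open>x\<close>.\<close>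

lemma nullity_delete_null_at:
  assumes "null_at V x"
  shows "nullity V = nullity (V - {x}) + 1"
proof -
  obtain v where v: "v \<in> null_space V" "v $ x \<noteq> 0" using assms unfolding null_at_def by auto
  have x: "x \<in> V" using assms null_at_mem by blast
  have "(S *v z) $ x = 0" if z: "z \<in> null_space (V - {x})" for z
  proof -
    have "inner z (S *v v) = 0"
      using z by (intro inner_null_space[OF v(1)]) (auto simp: null_space_def)
    then have "inner (S *v z) v = 0" by (simp add: skew_inner)
    moreover have "inner (S *v z) v = (S *v z) $ x * v $ x"
      using z v(1) by (intro inner_eq_single) (auto simp: null_space_def)
    ultimately show ?thesis using v(2) by simp
  qed
  then have "null_space (V - {x}) = {z \<in> null_space V. z $ x = 0}"
    unfolding null_space_def using x by auto
  moreover have "linear (\<lambda>z :: real^'a. z $ x)"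
    by (simp add: linear_iff)
  ultimately show ?thesis
    unfolding nullity_def using dim_kernel_functional[OF subspace_null_space, of "\<lambda>z. z $ x"] v by simp
qed

text \<open>A coordinate vector orthogonal to the kernel of \<open>S\<close> restricted to \<open>V\<close> lies in
  its range, by skew-symmetry.\<close>
lemma obtain_preimage:
  assumes x: "x \<in> V" and no: "\<not> null_at V x"
  obtains w where "\<And>i. i \<notin> V \<Longrightarrow> w $ i = 0" "\<And>i. i \<in> V \<Longrightarrow> (S *v w) $ i = (if i = x then 1 else 0)"
    "w $ x = 0"
proof -
  define proj :: "real^'a \<Rightarrow> real^'a" where "proj w = (\<chi> i. if i \<in> V then w $ i else 0)" for w
  define g where "g v = proj (S *v proj v)" for v
  have proj: "linear proj" by (auto simp: linear_iff proj_def vec_eq_iff)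
  have "linear g" unfolding g_def
    using linear_compose[OF linear_compose[OF proj matrix_vector_mul_linear[of S]] proj]
    by (simp add: o_def)
  then have sub: "subspace (range g)" using linear_subspace_image subspace_UNIV by blast
  \<comment> \<open>The part \<open>p\<close> orthogonal to the range is a null vector on
    \<open>V\<close>, so it vanishes at \<open>x\<close>; being orthogonal to \<open>r\<close> as
    well, it is 0.\<close>
  obtain r p where rp: "r \<in> span (range g)" "\<And>w. w \<in> span (range g) \<Longrightarrow> orthogonal p w"
    "axis x 1 = r + p"
    using orthogonal_subspace_decomp_exists[of "range g" "axis x 1"] by metis
  have "r \<in> range g" using rp(1) sub by (metis span_eq_iff)
  then obtain v where v: "r = g v" by auto
  have r0: "r $ i = 0" if "i \<notin> V" for i using that by (simp add: v g_def proj_def)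
  have p0: "p $ i = 0" if "i \<notin> V" for i
  proof -
    have "(axis x 1 :: real^'a) $ i = r $ i + p $ i" using rp(3) by simp
    then show ?thesis using that r0 x by (auto simp: axis_def split: if_splits)
  qed
  have proj_inner: "inner p (proj w) = inner p w" for w
    unfolding inner_vec_def proj_def using p0 by (intro sum.cong) auto
  have "(S *v p) $ i = 0" if i: "i \<in> V" for i
  proof -
    have "proj (axis i 1) = axis i 1" using i by (auto simp: proj_def vec_eq_iff axis_def)
    then have "inner p (g (axis i 1)) = - inner (S *v p) (axis i 1)"
      by (simp add: g_def proj_inner skew_inner)
    moreover have "inner p (g (axis i 1)) = 0"
      using rp(2) span_base[of "g (axis i 1)" "range g"] by (auto simp: orthogonal_def)
    ultimately show ?thesis by (simp add: inner_axis)
  qed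
  then have "p \<in> null_space V" unfolding null_space_def using p0 by auto
  then have "p $ x = 0" using no unfolding null_at_def by auto
  then have "inner p (axis x 1) = 0" by (simp add: inner_axis)
  moreover have "inner p r = 0" using rp(1,2) by (auto simp: orthogonal_def)
  ultimately have "inner p p = 0" using rp(3) by (simp add: inner_add_right)
  then have eq: "axis x 1 = g v" using rp(3) v by simp
  let ?w = "proj v"
  have 1: "?w $ i = 0" if "i \<notin> V" for i using that by (simp add: proj_def)
  have 2: "(S *v ?w) $ i = (if i = x then 1 else 0)" if "i \<in> V" for i
  proof -
    have "g v $ i = (S *v ?w) $ i" using that by (simp add: g_def proj_def)
    then show ?thesis using eq[symmetric] by (simp add: axis_def)
  qed
  \<comment> \<open>By skew-symmetry this quadratic form is 0, and its value is the entry of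
    \<open>?w\<close> at \<open>x\<close>.\<close>
  have "inner ?w (S *v ?w) = ?w $ x * (S *v ?w) $ x"
    using 1 2 by (intro inner_eq_single) (metis mult_eq_0_iff)
  then have 3: "?w $ x = 0" using skew_inner_self[of ?w] 2[OF x] by simp
  show ?thesis using that 1 2 3 by blast
qed

text \<open>All null vectors on \<open>V\<close> vanish at \<open>x\<close>, so they are the null
  vectors on \<open>V - {x}\<close> satisfying row \<open>x\<close>; the preimage \<open>w\<close>
  violates that row.\<close>

lemma nullity_delete_not_null_at:
  assumes "x \<in> V" "\<not> null_at V x"
  shows "nullity (V - {x}) = nullity V + 1"
proof -
  obtain w where w: "\<And>i. i \<notin> V \<Longrightarrow> w $ i = 0"
    "\<And>i. i \<in> V \<Longrightarrow> (S *v w) $ i = (if i = x then 1 else 0)" "w $ x = 0"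
    using obtain_preimage[OF assms] by metis
  have "w \<in> null_space (V - {x})" "(S *v w) $ x \<noteq> 0"
    unfolding null_space_def using w assms(1) by auto
  moreover have "linear (\<lambda>z. (S *v z) $ x)"
    by (simp add: linear_iff matrix_vector_right_distrib matrix_vector_mult_scaleR)
  moreover have "null_space V = {z \<in> null_space (V - {x}). (S *v z) $ x = 0}"
    using assms unfolding null_space_def null_at_def by auto
  ultimately show ?thesis
    unfolding nullity_def using dim_kernel_functional[OF subspace_null_space[of "V - {x}"]] by simp
qed

lemma mult_vec_support:
  assumes "\<And>j. j \<notin> A \<Longrightarrow> S $ i $ j * v $ j = 0"
  shows "(S *v v) $ i = (\<Sum>j\<in>A. S $ i $ j * v $ j)"
  unfolding matrix_vector_mult_def using assms
  by simp (intro sum.mono_neutral_right; auto)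

lemma nullity_isolated:
  assumes "x \<in> V" "nbrs V x = {}"
  shows "nullity V = nullity (V - {x}) + 1"
proof (rule nullity_delete_null_at)
  have "(S *v axis x 1) $ i = 0" if "i \<in> V" for i
  proof -
    have "\<not> adj i x" using that assms sym unfolding nbrs_def by auto
    then show ?thesis using mult_vec_support[of "{x}" i "axis x 1"] nonadj
      by (auto simp: axis_def)
  qed
  then have "axis x 1 \<in> null_space V"
    unfolding null_space_def using assms by (auto simp: axis_def)
  then show "null_at V x" unfolding null_at_def by (auto intro!: bexI[of _ "axis x 1"])
qed

text \<open>Row \<open>x\<close> forces null vectors to vanish at \<open>y\<close>, so deleting
  \<open>y\<close> raises the nullity; \<open>x\<close> is then isolated, and deleting it lowers the
  nullity again.\<close>

lemma nullity_pendant: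
  assumes x: "x \<in> V" and y: "nbrs V x = {y}"
  shows "nullity V = nullity (V - {x, y})"
proof -
  have adj: "adj x y" "y \<in> V" "x \<noteq> y" using y irrefl unfolding nbrs_def by auto
  have "\<not> null_at V y"
  proof
    assume "null_at V y"
    then obtain v where v: "v \<in> null_space V" "v $ y \<noteq> 0" unfolding null_at_def by auto
    have "S $ x $ j * v $ j = 0" if "j \<notin> {y}" for j
      using that v(1) y nonadj[of x j] unfolding null_space_def nbrs_def by fastforce
    then have "(S *v v) $ x = S $ x $ y * v $ y" using mult_vec_support[of "{y}" x v] by simp
    moreover have "(S *v v) $ x = 0" using v(1) x unfolding null_space_def by auto
    ultimately show False using v(2) unit[OF adj(1)] by auto
  qed
  then have "nullity (V - {y}) = nullity V + 1" using nullity_delete_not_null_at adj by blast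
  moreover have "nbrs (V - {y}) x = {}" using y unfolding nbrs_def by auto
  then have "nullity (V - {y}) = nullity (V - {y} - {x}) + 1"
    using x adj by (intro nullity_isolated) auto
  moreover have "V - {y} - {x} = V - {x, y}" by auto
  ultimately show ?thesis by simp
qed

lemma rank_plus_nullity: "rank S + nullity UNIV = CARD('a)"
proof -
  have "null_space UNIV = {y \<in> UNIV. \<forall>x\<in>span (rows S). orthogonal x y}"
  proof -
    have "(\<forall>i. (S *v y) $ i = 0) \<longleftrightarrow> (\<forall>x\<in>rows S. orthogonal y x)" for y
      unfolding rows_def orthogonal_def
      by (auto simp: matrix_vector_mult_def row_def inner_vec_def mult.commute)
    moreover have "(\<forall>x\<in>rows S. orthogonal y x) \<longleftrightarrow> (\<forall>x\<in>span (rows S). orthogonal x y)" for y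
      using orthogonal_to_span[of _ "rows S" y] span_base[of _ "rows S"]
      by (meson orthogonal_commute)
    ultimately show ?thesis unfolding null_space_def by auto
  qed
  then have "nullity UNIV + dim (span (rows S)) = dim (UNIV :: (real^'a) set)"
    unfolding nullity_def
    using dim_subspace_orthogonal_to_vectors[of "span (rows S)" UNIV] by (simp add: subspace_span)
  then show ?thesis by (simp add: row_rank_def)
qed

section \<open>The excess of an induced subgraph\<close>

definition excess :: "'a set \<Rightarrow> int" where
  "excess V = 2 * int (indep_num V adj) + 2 * dim_cycle V adj - int (card V) - int (nullity V)"

lemma excess_empty [simp]: "excess {} = 0"
  by (simp add: excess_def)

lemma excess_isolated:
  assumes "x \<in> V" "nbrs V x = {}"
  shows "excess V = excess (V - {x})"
proof -
  have "x \<notin> on_cycle V adj" using low_degree_not_on_cycle[of V x] assms by simp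
  then show ?thesis
    using indep_num_isolated[OF assms] nullity_isolated[OF assms] card_delete[OF assms(1)]
      dim_cycle_delete_not_on_cycle[OF assms(1)] unfolding excess_def by simp
qed

text \<open>Independence number, vertices and nullity balance out; what remains is the drop of d at
  \<open>y\<close>, which may lie on a cycle.\<close>

lemma excess_pendant:
  assumes "x \<in> V" "nbrs V x = {y}"
  shows "excess V = excess (V - {x, y})
    + 2 * (dim_cycle (V - {x}) adj - dim_cycle (V - {x, y}) adj)"
proof -
  have y: "y \<in> V - {x}" using assms irrefl unfolding nbrs_def by auto
  have "x \<notin> on_cycle V adj" using low_degree_not_on_cycle[of V x] assms by simp
  moreover have "V - {x} - {y} = V - {x, y}" by auto
  ultimately show ?thesis
    using indep_num_pendant[OF assms] nullity_pendant[OF assms] card_delete[OF assms(1)]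
      card_delete[OF y] dim_cycle_delete_not_on_cycle[OF assms(1)]
    unfolding excess_def by simp
qed

text \<open>With no edges between \<open>F\<close> and \<open>R\<close>, low degree in
  \<open>F\<close> is low degree in the union, so \<open>F\<close> can be stripped. The general
  \<open>R\<close> serves to remove what is left of an end cycle after deleting its attachment
  vertex.\<close>

lemma excess_Un_forest:
  assumes "on_cycle F adj = {}" "R \<inter> F = {}"
    and "\<And>a b. a \<in> R \<Longrightarrow> b \<in> F \<Longrightarrow> \<not> adj a b"
  shows "excess (R \<union> F) = excess R"
  using finite[of F] assms
proof (induction F rule: finite_psubset_induct)
  case (psubset F)
  have smaller: "excess (R \<union> F') = excess R" if "F' \<subset> F" for F'
  proof (rule psubset.IH[OF that])
    show "on_cycle F' adj = {}" using psubset.prems(1) that on_cycle_mono[of F' F] by auto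
    show "R \<inter> F' = {}" using psubset.prems(2) that by auto
    show "\<not> adj a b" if "a \<in> R" "b \<in> F'" for a b
      using psubset.prems(3)[OF that(1)] that(2) \<open>F' \<subset> F\<close> by auto
  qed
  show ?case
  proof (cases "F = {}")
    case False
    then obtain x where x: "x \<in> F" "card (nbrs F x) \<le> 1"
      using acyclic_low_degree psubset.prems(1) by blast
    have nx: "nbrs (R \<union> F) x = nbrs F x"
      using psubset.prems(3) x(1) sym unfolding nbrs_def by blast
    from x(2) show ?thesis
    proof (cases rule: small_nbrs_cases)
      case 1
      then have "excess (R \<union> F) = excess (R \<union> F - {x})"
        using excess_isolated[of x "R \<union> F"] nx x by simp
      also have "R \<union> F - {x} = R \<union> (F - {x})" using psubset.prems(2) x by auto
      finally show ?thesis using smaller[of "F - {x}"] x by auto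
    next
      case (2 y)
      have y: "y \<in> F" "y \<noteq> x" using 2 irrefl unfolding nbrs_def by auto
      have "y \<notin> on_cycle (R \<union> F - {x}) adj"
      proof
        assume "y \<in> on_cycle (R \<union> F - {x}) adj"
        then obtain c where c: "is_cycle (R \<union> F - {x}) adj c" "y \<in> set c"
          unfolding on_cycle_def by auto
        have "set c \<subseteq> F"
          using psubset.prems(3) sym by (intro cycle_closed[OF c y(1)]) blast
        then have "is_cycle F adj c" using c(1) is_cycle_restrict by blast
        then show False using psubset.prems(1) c(2) unfolding on_cycle_def by auto
      qed
      then have "dim_cycle (R \<union> F - {x}) adj = dim_cycle (R \<union> F - {x} - {y}) adj"
        using dim_cycle_delete_not_on_cycle[of y "R \<union> F - {x}"] y by simp
      moreover have "R \<union> F - {x} - {y} = R \<union> F - {x, y}" by auto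
      ultimately have "excess (R \<union> F) = excess (R \<union> F - {x, y})"
        using excess_pendant[of x "R \<union> F" y] nx 2 x by simp
      also have "R \<union> F - {x, y} = R \<union> (F - {x, y})" using psubset.prems(2) x y by auto
      finally show ?thesis using smaller[of "F - {x, y}"] x by auto
    qed
  qed simp
qed

lemma excess_forest: "on_cycle F adj = {} \<Longrightarrow> excess F = 0"
  using excess_Un_forest[of F "{}"] by simp

text \<open>Every correction term is nonnegative, as d drops by at least one. Hence the inequality
  by induction, and if the excess vanishes, so does each term.\<close>

lemma excess_delete_on_cycle:
  assumes "x \<in> on_cycle V adj"
  shows "excess V = excess (V - {x}) + 2 * (int (indep_num V adj) - int (indep_num (V - {x}) adj))
    + 2 * (dim_cycle V adj - dim_cycle (V - {x}) adj - 1) + (if null_at V x then 0 else 2)"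
proof -
  have x: "x \<in> V" using assms on_cycle_subset by auto
  show ?thesis
    using card_delete[OF x] nullity_delete_null_at[of V x] nullity_delete_not_null_at[OF x]
    unfolding excess_def by (cases "null_at V x") simp_all
qed

lemma excess_nonneg: "excess V \<ge> 0"
  using finite[of V]
proof (induction V rule: finite_psubset_induct)
  case (psubset V)
  show ?case
  proof (cases "on_cycle V adj = {}")
    case False
    then obtain x where x: "x \<in> on_cycle V adj" by auto
    then have "excess (V - {x}) \<ge> 0" using psubset on_cycle_subset by blast
    then show ?thesis
      using excess_delete_on_cycle[OF x] dim_cycle_delete_on_cycle[OF x] indep_num_delete_le[of V x]
      by (auto split: if_splits)
  qed (simp add: excess_forest)
qed

lemma excess_zero_delete:
  assumes "excess V = 0" "x \<in> on_cycle V adj"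
  shows "excess (V - {x}) = 0" "null_at V x" "indep_num (V - {x}) adj = indep_num V adj"
    "dim_cycle V adj = dim_cycle (V - {x}) adj + 1"
  using excess_delete_on_cycle[OF assms(2)] dim_cycle_delete_on_cycle[OF assms(2)]
    indep_num_delete_le[of V x] excess_nonneg[of "V - {x}"] assms(1)
  by (auto split: if_splits)

lemma excess_zero_cycles_disjoint: "excess V = 0 \<Longrightarrow> cycles_disjoint V adj"
  using excess_zero_delete(4) by (intro cycles_disjointI) simp

section \<open>Null vectors and cycles\<close>

text \<open>The first formula is the vanishing excess of the forest \<open>set c - {x}\<close>. It
  gives at least \<open>length c - 1\<close> for twice its independence number, while the whole
  cycle allows at most \<open>length c\<close>, so the two numbers agree.\<close>

lemma cycle_delete_counts:
  assumes dis: "cycles_disjoint V adj" and c: "is_cycle V adj c" and x: "x \<in> set c"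
  shows "2 * int (indep_num (set c - {x}) adj) = int (length c) - 1 + int (nullity (set c - {x}))"
    and "indep_num (set c - {x}) adj = indep_num (set c) adj"
proof -
  have cyc: "on_cycle (set c - {x}) adj = {}" using cycle_set_delete_acyclic[OF assms] .
  have "card (set c) = length c" using c distinct_card unfolding is_cycle_def by auto
  then show *: "2 * int (indep_num (set c - {x}) adj)
      = int (length c) - 1 + int (nullity (set c - {x}))"
    using excess_forest[OF cyc] dim_cycle_forest[OF cyc] card_delete[OF x]
    unfolding excess_def by simp
  show "indep_num (set c - {x}) adj = indep_num (set c) adj"
    using * indep_num_cycle[OF c] indep_num_delete_le[of "set c" x] by linarith
qed

text \<open>Otherwise \<open>set c - {x}\<close> has positive nullity, and the count makes twice its
  independence number at least the odd length, which is its upper bound and not attainable by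
  parity.\<close>

lemma null_at_odd_cycle:
  assumes dis: "cycles_disjoint V adj" and c: "is_cycle V adj c" and x: "x \<in> set c"
    and odd: "odd (length c)"
  shows "null_at (set c) x"
proof (rule ccontr)
  assume "\<not> null_at (set c) x"
  then have "nullity (set c - {x}) \<ge> 1" using nullity_delete_not_null_at[OF x] by simp
  moreover have "2 * indep_num (set c - {x}) adj \<le> length c"
    using indep_num_cycle[OF c] cycle_delete_counts(2)[OF dis c x] by simp
  then have "2 * indep_num (set c - {x}) adj < length c"
    using odd by (metis dvd_triv_left le_neq_implies_less)
  ultimately show False using cycle_delete_counts(1)[OF dis c x] by simp
qed

lemma cycle_row:
  assumes dis: "cycles_disjoint V adj" and c: "is_cycle V adj c" and i: "i < length c"
    and v: "\<And>w. adj (c ! (Suc i mod length c)) w \<Longrightarrow> w \<notin> set c \<Longrightarrow> v $ w = 0"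
  shows "(S *v v) $ (c ! (Suc i mod length c)) =
    S $ (c ! (Suc i mod length c)) $ (c ! i) * v $ (c ! i) +
    S $ (c ! (Suc i mod length c)) $ (c ! (Suc (Suc i) mod length c))
      * v $ (c ! (Suc (Suc i) mod length c))"
proof -
  let ?b = "c ! (Suc i mod length c)"
  have "(S *v v) $ ?b = (\<Sum>j\<in>{w \<in> set c. adj ?b w}. S $ ?b $ j * v $ j)"
  proof (rule mult_vec_support)
    fix j assume "j \<notin> {w \<in> set c. adj ?b w}"
    then show "S $ ?b $ j * v $ j = 0" using v[of j] nonadj[of ?b j] by auto
  qed
  then show ?thesis using cycle_nbrs[OF dis c i] by simp
qed

definition walk_prod :: "'a list \<Rightarrow> nat \<Rightarrow> real" where
  "walk_prod c m = (\<Prod>i<m. S $ (c ! i) $ (c ! (Suc i mod length c)))"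

lemma walk_prod_Suc:
  "walk_prod c (Suc m) = walk_prod c m * S $ (c ! m) $ (c ! (Suc m mod length c))"
  by (simp add: walk_prod_def)

text \<open>The rows at odd positions propagate a null vector around the cycle in steps of two;
  returning to the start forces the product of the entries to be 1.\<close>
lemma even_cycle_prod:
  assumes dis: "cycles_disjoint V adj" and c: "is_cycle V adj c" and even: "even (length c)"
    and out: "\<And>a b. a \<in> set c \<Longrightarrow> a \<noteq> c ! 0 \<Longrightarrow> b \<in> V \<Longrightarrow> adj a b \<Longrightarrow> b \<in> set c"
    and null: "null_at V (c ! 0)"
  shows "walk_prod c (length c) = 1"
proof -
  let ?k = "length c"
  obtain v where v: "v \<in> null_space V" "v $ (c ! 0) \<noteq> 0" using null unfolding null_at_def by auto
  have cc: "?k \<ge> 3" "distinct c" "set c \<subseteq> V" using c unfolding is_cycle_def by auto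
  have a: "\<And>i. i < ?k \<Longrightarrow> adj (c ! i) (c ! (Suc i mod ?k))" using c by (auto simp: is_cycle_def)
  have "v $ (c ! (2 * j mod ?k)) = walk_prod c (2 * j) * v $ (c ! 0)" if "2 * j \<le> ?k" for j
    using that
  proof (induction j)
    case 0
    then show ?case by (simp add: walk_prod_def)
  next
    case (Suc j)
    let ?i = "2 * j"
    have i: "?i < ?k" "Suc ?i < ?k" using Suc.prems even by auto
    let ?b = "c ! Suc ?i" and ?n = "c ! (Suc (Suc ?i) mod ?k)"
    \<comment> \<open>An odd position is not the start, the only vertex that \<open>out\<close>
      allows to have neighbours off the cycle.\<close>
    have b: "?b \<in> set c" "?b \<noteq> c ! 0" 
      using i cc nth_eq_iff_index_eq[OF cc(2), of "Suc ?i" 0] is_cycle_nonempty[OF c] by auto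
    have z: "v $ w = 0" if "adj ?b w" "w \<notin> set c" for w
      using out[OF b _ that(1)] that(2) v(1) unfolding null_space_def by auto
    have "(S *v v) $ ?b = S $ ?b $ (c ! ?i) * v $ (c ! ?i) + S $ ?b $ ?n * v $ ?n"
      using cycle_row[OF dis c i(1), of v] z i by simp
    moreover have "(S *v v) $ ?b = 0" using v(1) b(1) cc(3) unfolding null_space_def by auto
    ultimately have "S $ ?b $ ?n * v $ ?n = S $ (c ! ?i) $ ?b * v $ (c ! ?i)"
      using skew[of ?b "c ! ?i"] by simp
    then have "S $ ?b $ ?n * (S $ ?b $ ?n * v $ ?n) = S $ ?b $ ?n * (S $ (c ! ?i) $ ?b * v $ (c ! ?i))"
      by simp
    moreover have "S $ ?b $ ?n * S $ ?b $ ?n = 1" using unit a[OF i(2)] by blast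
    ultimately have "v $ ?n = S $ ?b $ ?n * (S $ (c ! ?i) $ ?b * v $ (c ! ?i))"
      by (simp flip: mult.assoc)
    also have "v $ (c ! ?i) = walk_prod c ?i * v $ (c ! 0)" using Suc i by simp
    finally show ?case using i by (simp add: walk_prod_Suc mult_ac)
  qed
  from this[of "?k div 2"] even have "v $ (c ! 0) = walk_prod c ?k * v $ (c ! 0)" by simp
  then show ?thesis using v(2) by simp
qed

text \<open>The vector has the partial products at even positions and 0 at odd ones. Rows at even
  positions see only zeros; in rows at odd positions two terms cancel by skew-symmetry.\<close>

lemma null_at_even_cycle:
  assumes dis: "cycles_disjoint V adj" and c: "is_cycle V adj c" and even: "even (length c)"
    and prod: "walk_prod c (length c) = 1"
  shows "null_at (set c) (c ! 0)"
proof -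
  let ?k = "length c"
  have cc: "?k \<ge> 3" "distinct c" "set c \<subseteq> V" using c unfolding is_cycle_def by auto
  have a: "\<And>i. i < ?k \<Longrightarrow> adj (c ! i) (c ! (Suc i mod ?k))" using c by (auto simp: is_cycle_def)
  define pos where "pos = inv_into {..<?k} ((!) c)"
  have pos: "pos (c ! i) = i" if "i < ?k" for i
    unfolding pos_def using that cc by (intro inv_into_f_f inj_on_nth) auto
  define u :: "real^'a" where
    "u = (\<chi> x. if x \<in> set c \<and> even (pos x) then walk_prod c (pos x) else 0)"
  have u: "u $ (c ! i) = (if even i then walk_prod c i else 0)" if "i < ?k" for i
    using that pos by (simp add: u_def)
  have row: "(S *v u) $ (c ! (Suc i mod ?k)) = 0" if i: "i < ?k" for i
  proof -
    let ?b = "c ! (Suc i mod ?k)" and ?n = "c ! (Suc (Suc i) mod ?k)"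
    have mlt: "Suc (Suc i) mod ?k < ?k" using cc by (intro mod_less_divisor) auto
    have eq: "(S *v u) $ ?b = S $ ?b $ (c ! i) * u $ (c ! i) + S $ ?b $ ?n * u $ ?n"
      by (rule cycle_row[OF dis c i]) (simp add: u_def)
    have par: "even (Suc (Suc i) mod ?k) \<longleftrightarrow> even i" using even by (simp add: dvd_mod_iff)
    show ?thesis
    proof (cases "even i")
      case False
      then show ?thesis using eq u[OF i] u[OF mlt] par by simp
    next
      case True
      then have si: "Suc i < ?k" using i even by (metis Suc_lessI even_Suc)
      have "u $ ?n = walk_prod c (Suc (Suc i))"
      proof (cases "Suc (Suc i) < ?k")
        case False
        \<comment> \<open>Where the cycle closes, the value at position 0 is the empty product,
          which equals the full product by assumption.\<close>
        then have "Suc (Suc i) = ?k" using si by simp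
        then show ?thesis using u[OF mlt] prod cc by (simp add: walk_prod_def)
      qed (use u[OF mlt] True in simp)
      then have "u $ ?n = walk_prod c i * S $ (c ! i) $ ?b * S $ ?b $ ?n"
        using si by (simp add: walk_prod_Suc)
      then have "S $ ?b $ ?n * u $ ?n
          = walk_prod c i * S $ (c ! i) $ ?b * (S $ ?b $ ?n * S $ ?b $ ?n)"
        by (simp only: mult_ac)
      moreover have "S $ ?b $ ?n * S $ ?b $ ?n = 1"
        using unit a[OF si] si by simp
      ultimately have "S $ ?b $ ?n * u $ ?n = walk_prod c i * S $ (c ! i) $ ?b"
        by simp
      then show ?thesis using eq u[OF i] True skew[of ?b "c ! i"] by simp
    qed
  qed
  have "(S *v u) $ x = 0" if x: "x \<in> set c" for x
  proof -
    obtain i where i: "i < ?k" "x = c ! i" using x by (metis in_set_conv_nth)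
    let ?j = "(i + (?k - 1)) mod ?k"
    have "Suc (i + (?k - 1)) = i + ?k" using cc by linarith
    then have "Suc ?j mod ?k = i" using i by (simp only: mod_Suc_eq mod_add_self2 mod_less)
    moreover have "?j < ?k" using cc by (intro mod_less_divisor) auto
    ultimately show ?thesis using row[of ?j] i by simp
  qed
  then have "u \<in> null_space (set c)" unfolding null_space_def by (auto simp: u_def)
  moreover have "u $ (c ! 0) \<noteq> 0" using u[of 0] is_cycle_nonempty[OF c] by (simp add: walk_prod_def)
  ultimately show ?thesis unfolding null_at_def by blast
qed

text \<open>Pairing a null vector of \<open>V\<close> with a null vector of \<open>C\<close> isolates the single
  boundary edge \<open>xy\<close>.\<close>
lemma null_at_end_component:
  assumes C: "C \<subseteq> V" and x: "null_at C x" and bd: "boundary V C = {(x, y)}"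
  shows "null_at V x \<longleftrightarrow> \<not> null_at (V - C) y"
proof
  obtain u where u: "u \<in> null_space C" "u $ x \<noteq> 0" using x unfolding null_at_def by auto
  have xy: "x \<in> C" "y \<in> V - C" "adj x y" using bd unfolding boundary_def by auto
  have edge: "a = x \<and> b = y" if "a \<in> C" "b \<in> V - C" "adj a b" for a b
    using that bd unfolding boundary_def by blast
  have row: "(S *v w) $ i = 0"
    if w: "\<And>j. j \<notin> C \<Longrightarrow> w $ j = 0" and i: "i \<in> V - C" "i \<noteq> y" for w :: "real^'a" and i
  proof -
    have "S $ i $ j * w $ j = 0" for j
      using w[of j] edge[of j i] i nonadj[of i j] sym by (cases "j \<in> C") auto
    then show ?thesis using mult_vec_support[of "{}"] by simp
  qed
  have rowy: "(S *v w) $ y = S $ y $ x * w $ x" if w: "\<And>j. j \<notin> C \<Longrightarrow> w $ j = 0" for w :: "real^'a"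
  proof -
    have "S $ y $ j * w $ j = 0" if "j \<notin> {x}" for j
      using w[of j] edge[of j y] that xy nonadj[of y j] sym by (cases "j \<in> C") auto
    then show ?thesis using mult_vec_support[of "{x}"] by simp
  qed
  have Sxy: "S $ y $ x \<noteq> 0" using unit[of y x] xy sym by auto
  have u0: "\<And>j. j \<notin> C \<Longrightarrow> u $ j = 0" using u(1) unfolding null_space_def by auto
  {
    assume "null_at V x"
    then obtain v where v: "v \<in> null_space V" "v $ x \<noteq> 0" unfolding null_at_def by auto
    have "inner u (S *v v) = 0" using u0 C by (intro inner_null_space[OF v(1)]) auto
    then have "inner (S *v u) v = 0" by (simp add: skew_inner)
    moreover have "inner (S *v u) v = (S *v u) $ y * v $ y"
    proof (rule inner_eq_single)
      fix i assume "i \<noteq> y"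
      then show "(S *v u) $ i * v $ i = 0"
        using row[OF u0, of i] u(1) v(1) unfolding null_space_def
        by (cases "i \<in> C"; cases "i \<in> V") auto
    qed
    ultimately have vy: "v $ y = 0" using rowy[OF u0] Sxy u(2) by auto
    show "\<not> null_at (V - C) y"
    proof
      assume "null_at (V - C) y"
      then obtain z where z: "z \<in> null_space (V - C)" "z $ y \<noteq> 0" unfolding null_at_def by auto
      \<comment> \<open>The part of \<open>v\<close> on \<open>C\<close>. Testing \<open>v\<close>
        and \<open>v - w\<close> against \<open>z\<close> leaves only the edge \<open>xy\<close>,
        whose contribution is nonzero.\<close>
      define w :: "real^'a" where "w = (\<chi> i. if i \<in> C then v $ i else 0)"
      have w0: "\<And>j. j \<notin> C \<Longrightarrow> w $ j = 0" by (simp add: w_def)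
      have "inner z (S *v v) = 0"
        using z(1) by (intro inner_null_space[OF v(1)]) (auto simp: null_space_def)
      moreover have "inner z (S *v (v - w)) = 0"
      proof -
        have "(S *v z) $ i * (v - w) $ i = 0" for i
          using z(1) v(1) unfolding null_space_def w_def by (cases "i \<in> C"; cases "i \<in> V") auto
        then have "inner (S *v z) (v - w) = 0" unfolding inner_vec_def by (intro sum.neutral) simp
        then show ?thesis by (simp add: skew_inner)
      qed
      ultimately have "inner z (S *v w) = 0"
        by (simp add: matrix_vector_mult_diff_distrib inner_diff_right)
      moreover have "inner z (S *v w) = z $ y * (S *v w) $ y"
      proof (rule inner_eq_single)
        fix i assume "i \<noteq> y"
        then show "z $ i * (S *v w) $ i = 0"
          using row[OF w0, of i] z(1) unfolding null_space_def by (cases "i \<in> V - C") auto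
      qed
      moreover have "w $ x = v $ x" using xy by (simp add: w_def)
      ultimately show False using rowy[OF w0] z(2) Sxy v(2) by auto
    qed
  }
  {
    assume "\<not> null_at (V - C) y"
    then obtain w where w: "\<And>i. i \<notin> V - C \<Longrightarrow> w $ i = 0"
      "\<And>i. i \<in> V - C \<Longrightarrow> (S *v w) $ i = (if i = y then 1 else 0)" "w $ y = 0"
      using obtain_preimage xy(2) by metis
    \<comment> \<open>\<open>u\<close> can fail only in row \<open>y\<close>; the preimage
      \<open>w\<close> of the coordinate vector at \<open>y\<close> repairs it, and
      \<open>w $ y = 0\<close> keeps the rows in \<open>C\<close> intact.\<close>
    define v where "v = u - (S $ y $ x * u $ x) *\<^sub>R w"
    have Sv: "S *v v = S *v u - (S $ y $ x * u $ x) *\<^sub>R (S *v w)"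
      by (simp add: v_def matrix_vector_mult_diff_distrib matrix_vector_mult_scaleR)
    have "(S *v v) $ i = 0" if i: "i \<in> V" for i
    proof (cases "i \<in> C")
      case True
      have "S $ i $ j * w $ j = 0" for j
        using w(1)[of j] w(3) edge[of i j] True nonadj[of i j] by (cases "j \<in> V - C") auto
      then have "(S *v w) $ i = 0" using mult_vec_support[of "{}"] by simp
      moreover have "(S *v u) $ i = 0" using u(1) True unfolding null_space_def by auto
      ultimately show ?thesis by (simp add: Sv)
    next
      case False
      then show ?thesis using w(2)[of i] row[OF u0, of i] rowy[OF u0] i
        by (cases "i = y") (auto simp: Sv)
    qed
    moreover have "v $ i = 0" if "i \<notin> V" for i
      using that u0[of i] w(1)[of i] C by (auto simp: v_def)
    ultimately have "v \<in> null_space V" unfolding null_space_def by auto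
    moreover have "v $ x \<noteq> 0" using u(2) w(1)[of x] xy by (simp add: v_def)
    ultimately show "null_at V x" unfolding null_at_def by blast
  }
qed

lemma null_at_component:
  assumes C: "C \<subseteq> V" and x: "null_at C x" and bd: "boundary V C = {}"
  shows "null_at V x"
proof -
  obtain u where u: "u \<in> null_space C" "u $ x \<noteq> 0" using x unfolding null_at_def by auto
  have "(S *v u) $ i = 0" if i: "i \<in> V" for i
  proof (cases "i \<in> C")
    case False
    have "S $ i $ j * u $ j = 0" for j
      using u(1) bd i False nonadj[of i j] sym unfolding null_space_def boundary_def
      by (cases "j \<in> C") auto
    then show ?thesis using mult_vec_support[of "{}"] by simp
  qed (use u(1) in \<open>auto simp: null_space_def\<close>)
  then have "u \<in> null_space V" using u(1) C unfolding null_space_def by auto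
  then show ?thesis using u(2) unfolding null_at_def by blast
qed

section \<open>Vanishing excess\<close>

text \<open>Condition (ii), with positive sign written as product 1: entries on edges square to 1,
  so the product around a cycle is 1 or -1.\<close>

definition well_signed :: "'a set \<Rightarrow> bool" where
  "well_signed V \<longleftrightarrow> (\<forall>c. is_cycle V adj c \<longrightarrow> odd (length c) \<or> walk_prod c (length c) = 1)"

lemma well_signed_delete:
  assumes "A \<inter> on_cycle V adj = {}"
  shows "well_signed (V - A) \<longleftrightarrow> well_signed V"
  unfolding well_signed_def is_cycle_delete_iff[OF assms] by simp

lemma walk_prod_rotate: "walk_prod (rotate m c) (length c) = walk_prod c (length c)"
proof (cases "c = []")
  case False
  have "walk_prod (rotate m c) (length c)
    = (\<Prod>i<length c. S $ (c ! ((m + i) mod length c)) $ (c ! (Suc ((m + i) mod length c) mod length c)))"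
    unfolding walk_prod_def
    by (intro prod.cong refl) (simp only: lessThan_iff length_rotate nth_rotate nth_rotate_Suc)
  also have "\<dots> = walk_prod c (length c)"
    unfolding walk_prod_def
    using prod.reindex_bij_betw[OF bij_betw_shift_mod[of "length c" m],
        of "\<lambda>i. S $ (c ! i) $ (c ! (Suc i mod length c))"] False by simp
  finally show ?thesis .
qed (simp add: walk_prod_def)

lemma null_at_cycle:
  assumes dis: "cycles_disjoint V adj" and ws: "odd (length c) \<or> walk_prod c (length c) = 1"
    and c: "is_cycle V adj c" and x: "x \<in> set c"
  shows "null_at (set c) x"
proof (cases "odd (length c)")
  case False
  obtain m where m: "rotate m c ! 0 = x" using obtain_rotation[OF x] .
  have "null_at (set (rotate m c)) (rotate m c ! 0)"
    using ws False walk_prod_rotate[of m c]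
    by (intro null_at_even_cycle[OF dis is_cycle_rotate[OF c]]) simp_all
  then show ?thesis using m by simp
qed (use null_at_odd_cycle[OF dis c x] in simp)

text \<open>Deleting \<open>x\<close> cuts the rest of the cycle off from \<open>V - set c\<close>.
  That rest is a forest without excess, and it has the independence number of the whole
  cycle.\<close>

lemma end_cycle_excess:
  assumes dis: "cycles_disjoint V adj" and c: "is_cycle V adj c" and x: "x \<in> set c"
    and bd: "boundary V (set c) \<subseteq> {x} \<times> UNIV"
  shows "excess (V - {x}) = excess (V - set c)"
    and "indep_num (V - {x}) adj = indep_num V adj"
proof -
  have cV: "set c \<subseteq> V" using c unfolding is_cycle_def by auto
  have un: "V - {x} = (V - set c) \<union> (set c - {x})" "V = (V - set c) \<union> set c" using cV x by auto
  have no: "\<not> adj a b \<and> \<not> adj b a" if "a \<in> V - set c" "b \<in> set c - {x}" for a b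
    using that bd sym unfolding boundary_def by blast
  show "excess (V - {x}) = excess (V - set c)"
    unfolding un(1) using cycle_set_delete_acyclic[OF dis c x] no
    by (intro excess_Un_forest) auto
  have "indep_num V adj \<le> indep_num (V - set c) adj + indep_num (set c) adj"
    using indep_num_Un_le[of "V - set c" "set c" adj] un(2) by simp
  also have "\<dots> = indep_num (V - set c) adj + indep_num (set c - {x}) adj"
    using cycle_delete_counts(2)[OF dis c x] by simp
  also have "\<dots> = indep_num (V - {x}) adj"
    unfolding un(1) using no by (intro indep_num_Un_nonadj[symmetric]) auto
  finally show "indep_num (V - {x}) adj = indep_num V adj"
    using indep_num_delete_le[of V x] by simp
qed

lemma excess_zero_imp:
  "excess V = 0 \<Longrightarrow> well_signed V \<and> separated V"
  using finite[of V]
proof (induction V rule: finite_psubset_induct)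
  case (psubset V)
  have dis: "cycles_disjoint V adj" using psubset.prems excess_zero_cycles_disjoint by blast
  consider (empty) "V = {}" | (low) x where "x \<in> V" "card (nbrs V x) \<le> 1"
    | (cyc) c where "is_cycle V adj c" "card (boundary V (set c)) \<le> 1"
    using low_degree_or_end_cycle[OF dis] by blast
  then show ?case
  proof cases
    case empty
    have "well_signed {}" unfolding well_signed_def is_cycle_def by auto
    then show ?thesis using empty separated_empty by simp
  next
    case low
    have x: "x \<notin> on_cycle V adj" using low_degree_not_on_cycle low(2) by blast
    from low(2) show ?thesis
    proof (cases rule: small_nbrs_cases)
      case 1
      have "excess (V - {x}) = 0" using excess_isolated[OF low(1) 1] psubset.prems by simp
      then have "well_signed (V - {x}) \<and> separated (V - {x})" using psubset.IH low(1) by blast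
      then show ?thesis
        using separated_isolated_iff[OF low(1) 1] well_signed_delete[of "{x}" V] x by simp
    next
      case (2 y)
      have y: "y \<in> V - {x}" using 2 irrefl unfolding nbrs_def by auto
      have eq: "V - {x} - {y} = V - {x, y}" by auto
      \<comment> \<open>Otherwise deleting \<open>y\<close> would lower d, making the correction
        term of \<open>excess_pendant\<close> positive.\<close>
      have "y \<notin> on_cycle (V - {x}) adj"
      proof
        assume "y \<in> on_cycle (V - {x}) adj"
        then have "excess V > 0"
          using dim_cycle_delete_on_cycle[of y "V - {x}"] excess_pendant[OF low(1) 2]
            excess_nonneg[of "V - {x, y}"] unfolding eq by simp
        then show False using psubset.prems by simp
      qed
      then have "excess (V - {x, y}) = 0" and yo: "y \<notin> on_cycle V adj"
        using dim_cycle_delete_not_on_cycle[OF y] excess_pendant[OF low(1) 2] psubset.prems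
          on_cycle_delete(1)[of "{x}" V] x unfolding eq by simp_all
      then have "well_signed (V - {x, y}) \<and> separated (V - {x, y})"
        using psubset.IH[of "V - {x, y}"] low(1) by blast
      then show ?thesis
        using separated_pendant_iff[OF low(1) 2 yo] well_signed_delete[of "{x, y}" V] x yo
        by simp
    qed
  next
    case cyc
    define C where "C = set c"
    define R where "R = V - C"
    have c: "is_cycle V adj c" by fact
    have C: "C \<subseteq> V" "C \<noteq> {}" "C \<subseteq> on_cycle V adj"
      using c is_cycle_nonempty[OF c] unfolding C_def is_cycle_def on_cycle_def by auto
    obtain x where x: "x \<in> C" and bd: "boundary V C \<subseteq> {x} \<times> UNIV"
    proof -
      from cyc(2) show ?thesis
      proof (cases rule: boundary_cases)
        case 1
        obtain z where "z \<in> C" using C(2) by auto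
        then show ?thesis using that[of z] 1 unfolding C_def by simp
      next
        case (2 z y)
        then have "z \<in> C" unfolding boundary_def C_def by auto
        then show ?thesis using that[of z] 2 unfolding C_def by simp
      qed
    qed
    have xo: "x \<in> on_cycle V adj" using x C by auto
    have R0: "excess R = 0"
      using end_cycle_excess(1)[OF dis c] x bd excess_zero_delete(1)[OF psubset.prems xo]
      unfolding C_def R_def by simp
    have RV: "R \<subset> V" using C unfolding R_def by auto
    have IH: "well_signed R" "separated R" using psubset.IH[OF RV R0] by auto
    have nullV: "null_at V x" using excess_zero_delete(2)[OF psubset.prems xo] .
    \<comment> \<open>A cycle on other vertices lies in \<open>R\<close>. A cycle on
      \<open>C\<close>, rotated to start at \<open>x\<close>, can be left only at its start, so the
      null vector at \<open>x\<close> fixes its product.\<close>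
    have ws: "odd (length c') \<or> walk_prod c' (length c') = 1" if c': "is_cycle V adj c'" for c'
    proof (cases "set c' = C")
      case False
      then have "is_cycle R adj c'" using is_cycle_delete_cycle_iff[OF dis c] c'
        unfolding R_def C_def by blast
      then show ?thesis using IH(1) unfolding well_signed_def by blast
    next
      case True
      obtain m where m: "rotate m c' ! 0 = x" using obtain_rotation[of x c'] x True by auto
      have "walk_prod (rotate m c') (length (rotate m c')) = 1" if "even (length c')"
      proof (rule even_cycle_prod[OF dis is_cycle_rotate[OF c']])
        show "even (length (rotate m c'))" using that by simp
        show "null_at V (rotate m c' ! 0)" using nullV m by simp
        fix a b assume "a \<in> set (rotate m c')" "a \<noteq> rotate m c' ! 0" "b \<in> V" "adj a b"
        then show "b \<in> set (rotate m c')"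
          using bd True m unfolding boundary_def by auto
      qed
      then show ?thesis using walk_prod_rotate[of m c'] by auto
    qed
    then have wsV: "well_signed V" unfolding well_signed_def by blast
    have nullC: "null_at C x" using null_at_cycle[OF dis ws[OF c] c] x unfolding C_def by blast
    have oR: "on_cycle R adj = on_cycle V adj - C" "Gamma_V R adj = Gamma_V V adj"
      using on_cycle_delete_cycle[OF dis c] unfolding R_def C_def by auto
    from cyc(2)[folded C_def] have "separated V"
    proof (cases rule: boundary_cases)
      case 1
      obtain I where I: "avoiding_max R I" using IH(2) unfolding separated_def by auto
      have "\<not> adj i w" if "i \<in> I" "w \<in> C" for i w
      proof
        assume "adj i w"
        moreover have "i \<in> V - C" using that I C oR
          unfolding avoiding_max_def independent_set_def Gamma_V_def by auto
        ultimately have "(w, i) \<in> boundary V C" using that sym unfolding boundary_def by auto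
        then show False using 1 by simp
      qed
      then have "avoiding_max V I" using I unfolding avoiding_max_def oR by blast
      moreover have "cycles_nonadjacent V"
        using 1 IH(2) unfolding separated_def R_def C_def
        by (intro cycles_nonadjacent_delete_cycle[OF dis c]) auto
      ultimately show ?thesis unfolding separated_def by auto
    next
      case (2 x' y)
      then have [simp]: "x' = x" using bd by auto
      have y: "y \<in> R" using 2 unfolding boundary_def R_def by auto
      \<comment> \<open>The null vector at \<open>x\<close> on \<open>V\<close> excludes one at
        \<open>y\<close> on \<open>R\<close>. As each cycle vertex of \<open>R\<close> carries one,
        \<open>y\<close> lies on no cycle.\<close>
      have nn: "\<not> null_at R y"
        using null_at_end_component[OF C(1) nullC] 2 nullV unfolding R_def by simp
      have yo: "y \<notin> on_cycle R adj" using excess_zero_delete(2)[OF R0] nn by blast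
      then have yoV: "y \<notin> on_cycle V adj" using y oR unfolding R_def by auto
      \<comment> \<open>One vertex is traded for one unit of nullity, so only the independence
        number can change the excess; it cannot grow, and the excess cannot become negative.\<close>
      have "excess (R - {y}) = 2 * (int (indep_num (R - {y}) adj) - int (indep_num R adj))"
        using R0 nullity_delete_not_null_at[OF y nn] dim_cycle_delete_not_on_cycle[OF y yo]
          card_delete[OF y] unfolding excess_def by simp
      then have R1: "excess (R - {y}) = 0" and \<alpha>: "indep_num (R - {y}) adj = indep_num R adj"
        using excess_nonneg[of "R - {y}"] indep_num_delete_le[of R y] by simp_all
      have sR1: "separated (R - {y})" using psubset.IH[OF _ R1] RV by blast
      have oR1: "on_cycle (R - {y}) adj = on_cycle R adj" "Gamma_V (R - {y}) adj = Gamma_V V adj - {y}"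
        using on_cycle_delete[of "{y}" R] yo oR by auto
      \<comment> \<open>The cycle vertices contribute equally to both independence numbers, so Gamma
        loses nothing without \<open>y\<close>.\<close>
      have \<Gamma>: "indep_num (Gamma_V V adj - {y}) adj = indep_num (Gamma_V V adj) adj"
        using indep_num_separated[OF IH(2)] indep_num_separated[OF sR1] \<alpha> oR1 oR(2) by simp
      obtain I where I: "avoiding_max (R - {y}) I" using sR1 unfolding separated_def by auto
      have I': "I \<subseteq> Gamma_V V adj - {y}" "\<forall>a\<in>I. \<forall>b\<in>I. \<not> adj a b"
        using I oR1 unfolding avoiding_max_def independent_set_def by auto
      have "\<not> adj i w" if "i \<in> I" "w \<in> C" for i w
      proof
        assume "adj i w"
        moreover have "i \<in> V - C" using that I' C unfolding Gamma_V_def by auto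
        ultimately have "(w, i) \<in> boundary V C" using that sym unfolding boundary_def by auto
        then show False using 2 I' that by auto
      qed
      moreover have "independent_set (Gamma_V V adj) adj I"
        using I' unfolding independent_set_def by auto
      ultimately have "avoiding_max V I" using I \<Gamma> unfolding avoiding_max_def oR1 oR(1) by force
      moreover have "cycles_nonadjacent V"
        using 2 yoV IH(2) unfolding separated_def R_def C_def
        by (intro cycles_nonadjacent_delete_cycle[OF dis c]) auto
      ultimately show ?thesis unfolding separated_def by auto
    qed
    then show ?thesis using wsV by blast
  qed
qed

lemma excess_zeroI:
  "cycles_disjoint V adj \<Longrightarrow> well_signed V \<Longrightarrow> separated V \<Longrightarrow> excess V = 0"
  using finite[of V]
proof (induction V rule: finite_psubset_induct)
  case (psubset V)
  note dis = psubset.prems(1)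
  consider (empty) "V = {}" | (low) x where "x \<in> V" "card (nbrs V x) \<le> 1"
    | (cyc) c where "is_cycle V adj c" "card (boundary V (set c)) \<le> 1"
    using low_degree_or_end_cycle[OF dis] by blast
  then show ?case
  proof cases
    case low
    have x: "x \<notin> on_cycle V adj" using low_degree_not_on_cycle low(2) by blast
    from low(2) show ?thesis
    proof (cases rule: small_nbrs_cases)
      case 1
      have "excess (V - {x}) = 0"
        using psubset.prems cycle_properties_delete[of "{x}" V] well_signed_delete[of "{x}" V] x separated_isolated_iff[OF low(1) 1] low(1)
        by (intro psubset.IH) auto
      then show ?thesis using excess_isolated[OF low(1) 1] by simp
    next
      case (2 y)
      have y: "y \<in> V - {x}" using 2 irrefl unfolding nbrs_def by auto
      have yo: "y \<notin> on_cycle V adj"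
        using separated_pendant_not_on_cycle[OF psubset.prems(3) low(1) 2] .
      then have yo': "y \<notin> on_cycle (V - {x}) adj" using on_cycle_mono[of "V - {x}" V] by auto
      have eq: "V - {x} - {y} = V - {x, y}" by auto
      have "excess (V - {x, y}) = 0"
        using psubset.prems cycle_properties_delete[of "{x, y}" V] well_signed_delete[of "{x, y}" V] x yo
          separated_pendant_iff[OF low(1) 2 yo] low(1)
        by (intro psubset.IH) auto
      then show ?thesis
        using excess_pendant[OF low(1) 2] dim_cycle_delete_not_on_cycle[OF y yo'] unfolding eq by simp
    qed
  next
    case cyc
    define C where "C = set c"
    define R where "R = V - C"
    have c: "is_cycle V adj c" by fact
    have C: "C \<subseteq> V" "C \<noteq> {}" "C \<subseteq> on_cycle V adj"
      using c is_cycle_nonempty[OF c] unfolding C_def is_cycle_def on_cycle_def by auto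
    have RV: "R \<subset> V" using C unfolding R_def by auto
    have ws: "odd (length c) \<or> walk_prod c (length c) = 1"
      using psubset.prems(2) c unfolding well_signed_def by blast
    have oR: "on_cycle R adj = on_cycle V adj - C" "Gamma_V R adj = Gamma_V V adj"
      using on_cycle_delete_cycle[OF dis c] unfolding R_def C_def by auto
    have mono: "cycles_disjoint R adj" "well_signed R" "cycles_nonadjacent R"
      using cycles_disjoint_mono[OF dis] psubset.prems(2,3) is_cycle_mono[of R adj _ V] RV
      unfolding well_signed_def separated_def cycles_nonadjacent_def by blast+
    obtain I where I: "avoiding_max V I" using psubset.prems(3) unfolding separated_def by auto
    then have "avoiding_max R I" unfolding avoiding_max_def oR by auto
    then have sR: "separated R" using mono(3) unfolding separated_def by auto
    have R0: "excess R = 0" using psubset.IH[OF RV mono(1,2) sR] .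
    \<comment> \<open>With a null vector at the attachment vertex, all correction terms of
      \<open>excess_delete_on_cycle\<close> vanish, and \<open>V - {x}\<close> has the excess of
      \<open>R\<close>.\<close>
    have fin: "excess V = 0" if x: "x \<in> C" "null_at V x" "boundary V C \<subseteq> {x} \<times> UNIV" for x
    proof -
      have xo: "x \<in> on_cycle V adj" using x C by auto
      show ?thesis
        using excess_delete_on_cycle[OF xo] dim_cycle_delete_unique_cycle[OF dis xo] x R0
          end_cycle_excess[OF dis c, of x] unfolding C_def R_def by simp
    qed
    from cyc(2)[folded C_def] show ?thesis
    proof (cases rule: boundary_cases)
      case 1
      obtain x where x: "x \<in> C" using C by auto
      have "null_at C x" using null_at_cycle[OF dis ws c] x unfolding C_def by blast
      then show ?thesis using fin[OF x] null_at_component[OF C(1) _ 1] 1 by simp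
    next
      case (2 x y)
      have xy: "x \<in> C" "y \<in> R" "adj x y" using 2 unfolding boundary_def R_def by auto
      have xo: "x \<in> on_cycle V adj" using xy C by auto
      have yo: "y \<notin> on_cycle R adj"
      proof
        assume "y \<in> on_cycle R adj"
        then obtain c' where c': "is_cycle R adj c'" "y \<in> set c'" unfolding on_cycle_def by auto
        then have "is_cycle V adj c' \<and> set c \<noteq> set c'"
          using is_cycle_delete_cycle_iff[OF dis c] unfolding R_def C_def by blast
        then show False using psubset.prems(3) c c'(2) xy
          unfolding separated_def cycles_nonadjacent_def C_def by blast
      qed
      \<comment> \<open>\<open>y\<close> has the neighbour \<open>x\<close> on a cycle, so the
        avoiding set misses \<open>y\<close> and stays maximum in Gamma without
        \<open>y\<close>.\<close>
      have "y \<notin> I" using I xo sym[OF xy(3)] unfolding avoiding_max_def by auto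
      then have I1: "independent_set (Gamma_V V adj - {y}) adj I"
        using I unfolding avoiding_max_def independent_set_def by auto
      have \<Gamma>: "indep_num (Gamma_V V adj - {y}) adj = indep_num (Gamma_V V adj) adj"
        using indep_num_ge[OF _ I1] indep_num_delete_le[of "Gamma_V V adj" y] I
        unfolding avoiding_max_def by simp
      have oR1: "on_cycle (R - {y}) adj = on_cycle R adj" "Gamma_V (R - {y}) adj = Gamma_V V adj - {y}"
        using on_cycle_delete[of "{y}" R] yo oR by auto
      have "avoiding_max (R - {y}) I"
        using I I1 \<Gamma> unfolding avoiding_max_def oR1 oR by auto
      then have sR1: "separated (R - {y})"
        using mono(3) cycle_properties_delete(2)[of "{y}" R] yo unfolding separated_def by auto
      have R1: "excess (R - {y}) = 0"
        using sR1 mono cycle_properties_delete[of "{y}" R] well_signed_delete[of "{y}" R] yo RV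
        by (intro psubset.IH) auto
      have \<alpha>: "indep_num (R - {y}) adj = indep_num R adj"
        using indep_num_separated[OF sR] indep_num_separated[OF sR1] \<Gamma> oR1 oR(2) by simp
      \<comment> \<open>Otherwise the nullity would drop with the deletion and the excess would grow
        by 2, but it is 0 both times.\<close>
      have "\<not> null_at R y"
        using R0 R1 \<alpha> nullity_delete_null_at[of R y] dim_cycle_delete_not_on_cycle[OF xy(2) yo]
          card_delete[OF xy(2)] unfolding excess_def by auto
      moreover have "null_at C x" using null_at_cycle[OF dis ws c] xy unfolding C_def by blast
      ultimately have "null_at V x"
        using null_at_end_component[OF C(1) _ 2] unfolding R_def by simp
      then show ?thesis using fin[OF xy(1)] 2 by simp
    qed
  qed simp
qed

theorem excess_zero_iff:
  "excess V = 0 \<longleftrightarrow> cycles_disjoint V adj \<and> well_signed V \<and> separated V"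
  using excess_zero_imp excess_zeroI excess_zero_cycles_disjoint by blast

lemma walk_prod_square:
  assumes "is_cycle V adj c"
  shows "walk_prod c (length c) * walk_prod c (length c) = 1"
  unfolding walk_prod_def prod.distrib[symmetric]
  using assms unit unfolding is_cycle_def by (intro prod.neutral) auto

lemma well_signed_iff:
  "well_signed V \<longleftrightarrow> (\<forall>c. is_cycle V adj c \<longrightarrow> odd (length c) \<or> walk_prod c (length c) > 0)"
proof -
  have "walk_prod c (length c) = 1 \<longleftrightarrow> walk_prod c (length c) > 0" if "is_cycle V adj c" for c
    using walk_prod_square[OF that] by (auto simp: square_eq_1_iff)
  then show ?thesis unfolding well_signed_def by blast
qed

end

section \<open>Back to oriented graphs\<close>

lemma skew_graph_oriented:
  assumes "oriented ori"
  shows "skew_graph (underlying ori) (skew_adj ori)"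
  using assms unfolding oriented_def underlying_def skew_adj_def
  by unfold_locales auto

theorem theorem1p1:
  fixes ori :: "'n::finite \<Rightarrow> 'n \<Rightarrow> bool"
  assumes "oriented ori"
    and "graph_connected UNIV (underlying ori)"
  shows "int (skew_rank ori) + 2 * int (indep_num UNIV (underlying ori))
           \<ge> 2 * int CARD('n) - 2 * dim_cycle UNIV (underlying ori)
         \<and> (int (skew_rank ori) + 2 * int (indep_num UNIV (underlying ori))
           = 2 * int CARD('n) - 2 * dim_cycle UNIV (underlying ori)
         \<longleftrightarrow> cycles_disjoint UNIV (underlying ori)
           \<and> cycles_odd_or_evenly ori
           \<and> int (indep_num (T_V UNIV (underlying ori)) (T_adj (underlying ori)))
               = int (indep_num (Gamma_V UNIV (underlying ori)) (underlying ori))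
                 + dim_cycle UNIV (underlying ori))"
proof -
  interpret skew_graph "underlying ori" "skew_adj ori"
    using skew_graph_oriented[OF assms(1)] .
  have excess: "excess UNIV = int (skew_rank ori) + 2 * int (indep_num UNIV (underlying ori))
      - (2 * int CARD('n) - 2 * dim_cycle UNIV (underlying ori))"
    using rank_plus_nullity unfolding excess_def skew_rank_def by simp
  have signs: "well_signed UNIV \<longleftrightarrow> cycles_odd_or_evenly ori"
    unfolding well_signed_iff cycles_odd_or_evenly_def walk_prod_def cycle_sign_prod_def ..
  \<comment> \<open>Condition (iii) has d where the contraction counts cycles; the two are
    identified under disjointness, hence the conditional form.\<close>
  have contraction: "separated UNIV \<longleftrightarrow>
      int (indep_num (T_V UNIV (underlying ori)) (T_adj (underlying ori)))
        = int (indep_num (Gamma_V UNIV (underlying ori)) (underlying ori))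
          + dim_cycle UNIV (underlying ori)"
    if "cycles_disjoint UNIV (underlying ori)"
    using indep_num_contraction_iff[of UNIV] dim_cycle_eq_card_cycles[OF that] by linarith
  show ?thesis
    using excess excess_nonneg[of UNIV] excess_zero_iff[of UNIV] signs contraction by auto
qed

end
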